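(* Let $d\ge3$ and let $G_4^L$ be the Lorentzian four-point function of identical scalar operators defined by Wick rotation from a Euclidean unitary CFT. Let $\alpha$ be a causal ordering of four points and let $\mathcal{D}_L^\alpha\subset\mathcal{D}_L$ be the set of all configurations with this causal ordering. - If $\mathcal{D}_L^\alpha$ is in class S, then at all configurations in $\mathcal{D}_L^\alpha$ only the s-channel expansion of $G_4^L$ is convergent. - If $\mathcal{D}_L^\alpha$ is in class T, then all configurations in $\mathcal{D}_L^\alpha$ have the same $N_t$. - If $\mathcal{D}_L^\alpha$ is in class U, then all configurations in $\mathcal{D}_L^\alpha$ have the same $N_u$. - If $\mathcal{D}_L^\alpha$ is in class E, then: (i) all configurations in $\mathcal{D}_L^\alpha\cap\mathrm{E_{st}}$ have convergent s-channel expansion and the same $N_t$; (ii) all configurations in $\mathcal{D}_L^\alpha\cap\mathrm{E_{su}}$ have convergent s-channel expansion and the same $N_u$; (iii) all configurations in $\mathcal{D}_L^\alpha\cap\mathrm{E_{tu}}$ have the same $N_t$ and the same $N_u$; (iv) all configurations in $\mathcal{D}_L^\alpha\cap\mathrm{E_{stu}}$ have convergent s-channel expansion, the same $N_t$ and the same $N_u$.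
   Context: Kinematics. Points are $x_k=(\tau_k,\mathbf{x}_k)$, $\tau_k\in\mathbb{C}$, $\mathbf{x}_k\in\mathbb{R}^{d-1}$; $x_{ij}^2=(\tau_i-\tau_j)^2+(\mathbf{x}_i-\mathbf{x}_j)^2$. $\mathcal{D}$ is the set of four-point configurations with $\mathrm{Re}\,\tau_1>\mathrm{Re}\,\tau_2>\mathrm{Re}\,\tau_3>\mathrm{Re}\,\tau_4$; $\mathcal{D}_E\subset\mathcal{D}$ is the subset with all $\tau_k$ real; $\mathcal{D}_L$ is the set of Lorentzian configurations $x_k=(it_k,\mathbf{x}_k)$ ($t_k$ real) with $x_{ij}^2\ne0$ for all $i\neq j$. $u=\frac{x_{12}^2x_{34}^2}{x_{13}^2x_{24}^2}$, $v=\frac{x_{14}^2x_{23}^2}{x_{13}^2x_{24}^2}$; $z,\bar z$ are the two solutions (unordered) of $u=z\bar z$, $v=(1-z)(1-\bar z)$. $\Gamma=\{C\in\mathcal{D}: z=\bar z\}$. Known fact (to be used as given): $z,\bar z\notin\{0\}\cup[1,\infty)$ on $\mathcal{D}$. $G_4^L(t_k,\mathbf{x}_k)=\lim G_4(\epsilon_k+it_k,\mathbf{x}_k)$ as $\epsilon_k\to0$ with $\epsilon_1>\epsilon_2>\epsilon_3>\epsilon_4$, where $G_4$ is the analytic continuation to $\mathcal{D}$ of the Euclidean four-point function. Causal ordering. For Lorentzian points, $x_i\to x_j$ means $t_j-t_i>|\mathbf{x}_i-\mathbf{x}_j|$. The causal ordering of $(x_1,x_2,x_3,x_4)\in\mathcal{D}_L$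 is the directed graph on $\{1,2,3,4\}$ with an arrow $i\to j$ whenever $x_i\to x_j$. Classes. On $\mathcal{D}_L$, $u,v$ are real and $z,\bar z\ne0,1$, and $z,\bar z$ are either both real or complex conjugate. Class S: one of $z,\bar z$ in $(0,1)$ and the other in $(-\infty,0)$. Class T: one in $(1,\infty)$ and the other in $(0,1)$. Class U: one in $(1,\infty)$ and the other in $(-\infty,0)$. Class E: the rest, subdivided into $\mathrm{E_{su}}$ ($z,\bar z<0$), $\mathrm{E_{st}}$ ($0<z,\bar z<1$), $\mathrm{E_{tu}}$ ($z,\bar z>1$), $\mathrm{E_{stu}}$ ($z^*=\bar z$ not real). For $d\ge3$ each $\mathcal{D}_L^\alpha$ is contained in a single class S, T, U or E. Paths and crossing numbers. For $C\in\mathcal{D}_L$ take a continuous path $\gamma:[0,1]\to\overline{\mathcal{D}}$ with $\gamma(0)\in\mathcal{D}_E\setminus\Gamma$, $\gamma(s)\in\mathcal{D}\setminus\Gamma$ for $s<1$, $\gamma(1)=C$. At $\gamma(0)$, $\bar z=z^*$ is non-real; label so that $\mathrm{Im}\,z>0$ and continue $z,\bar z$ continuously. If at $C$ $z,\bar z\notin(-\infty,0)$: $n_t$ is the number of times $z$ crosses $(-\infty,0)$ from above minus the number of times from below along $\gamma$, $\bar n_t$ the same for $\bar z$, and $N_t(C)=n_t+\bar n_t$. If at $C$ $z,\bar z\notin(0,1)$: $N_u(C)=n_u+\bar n_u$ is defined in the same way with $(-\infty,0)$ replaced by $(0,1)$. $N_t(C)$ and $N_u(C)$ do not depend on $\gamma$.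 Channel convergence. In the paper's convention, at $C\in\mathcal{D}_L$ the s-channel expansion is (established to be) convergent iff $z,\bar z\notin(1,\infty)$; the t-channel iff $z,\bar z\notin(-\infty,0)$ and $N_t(C)=0$; the u-channel iff $z,\bar z\notin(0,1)$ and $N_u(C)=0$. "Only the s-channel expansion is convergent" means that the s-channel criterion holds and the t- and u-channel criteria fail. *)

theory Defs
  imports "HOL-Analysis.Analysis"
begin

text \<open>
  A point of \<open>d\<close>-dimensional space with complexified time is a pair \<open>(\<tau>, x)\<close>, where the index type
  of the spatial part has \<open>d - 1\<close> elements.  A configuration consists of four points, labelled by
  \<open>1, 2, 3, 4 :: 4\<close>.  (In the type \<open>4\<close> the numeral \<open>4\<close> is the element \<open>0\<close>; the four labels are
  distinct and exhaust the type, and no order on the type is used.)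
\<close>

type_synonym 'n point = "complex \<times> (real ^ 'n)"
type_synonym 'n config = "'n point ^ 4"

definition tau :: "'n::finite config \<Rightarrow> 4 \<Rightarrow> complex" where
  "tau C k = fst (C $ k)"

definition space_part :: "'n::finite config \<Rightarrow> 4 \<Rightarrow> real ^ 'n" where
  "space_part C k = snd (C $ k)"

definition sqdist :: "'n::finite config \<Rightarrow> 4 \<Rightarrow> 4 \<Rightarrow> complex" where
  "sqdist C i j = (tau C i - tau C j)\<^sup>2 + of_real ((norm (space_part C i - space_part C j))\<^sup>2)"

definition confs :: "'n::finite config set" where
  "confs = {C. Re (tau C 1) > Re (tau C 2) \<and> Re (tau C 2) > Re (tau C 3) \<and> Re (tau C 3) > Re (tau C 4)}"

definition confs_E :: "'n::finite config set" where
  "confs_E = {C \<in> confs. \<forall>k. tau C k \<in> \<real>}"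

definition confs_L :: "'n::finite config set" where
  "confs_L = {C. (\<forall>k. Re (tau C k) = 0) \<and> (\<forall>i j. i \<noteq> j \<longrightarrow> sqdist C i j \<noteq> 0)}"

definition cross_u :: "'n::finite config \<Rightarrow> complex" where
  "cross_u C = (sqdist C 1 2 * sqdist C 3 4) / (sqdist C 1 3 * sqdist C 2 4)"

definition cross_v :: "'n::finite config \<Rightarrow> complex" where
  "cross_v C = (sqdist C 1 4 * sqdist C 2 3) / (sqdist C 1 3 * sqdist C 2 4)"

text \<open>
  The unordered pair \<open>z, zb\<close> is represented by a relation that is symmetric in \<open>z\<close> and \<open>zb\<close>.
\<close>

definition is_zzb :: "'n::finite config \<Rightarrow> complex \<Rightarrow> complex \<Rightarrow> bool" where
  "is_zzb C z zb \<longleftrightarrow> cross_u C = z * zb \<and> cross_v C = (1 - z) * (1 - zb)"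

definition Gamma_set :: "'n::finite config set" where
  "Gamma_set = {C \<in> confs. \<exists>z zb. is_zzb C z zb \<and> z = zb}"


subsection \<open>Causal orderings\<close>

text \<open>The Lorentzian time of \<open>x\<^sub>k = (i t\<^sub>k, x\<^sub>k)\<close> is the imaginary part of \<open>\<tau>\<^sub>k\<close>.\<close>

definition causally_before :: "'n::finite config \<Rightarrow> 4 \<Rightarrow> 4 \<Rightarrow> bool" where
  "causally_before C i j \<longleftrightarrow>
     Im (tau C j) - Im (tau C i) > norm (space_part C i - space_part C j)"

definition causal_ordering :: "'n::finite config \<Rightarrow> (4 \<times> 4) set" where
  "causal_ordering C = {(i, j). causally_before C i j}"

definition confs_L_ordered :: "(4 \<times> 4) set \<Rightarrow> 'n::finite config set" where
  "confs_L_ordered \<alpha> = {C \<in> confs_L. causal_ordering C = \<alpha>}"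


subsection \<open>Classes of Lorentzian configurations\<close>

definition neg_axis :: "complex set" where
  "neg_axis = of_real ` {..<(0::real)}"

definition unit_interval :: "complex set" where
  "unit_interval = of_real ` {0<..<(1::real)}"

definition beyond_one :: "complex set" where
  "beyond_one = of_real ` {(1::real)<..}"

definition class_S :: "'n::finite config set" where
  "class_S = {C \<in> confs_L. \<exists>z zb. is_zzb C z zb \<and> z \<in> unit_interval \<and> zb \<in> neg_axis}"

definition class_T :: "'n::finite config set" where
  "class_T = {C \<in> confs_L. \<exists>z zb. is_zzb C z zb \<and> z \<in> beyond_one \<and> zb \<in> unit_interval}"

definition class_U :: "'n::finite config set" where
  "class_U = {C \<in> confs_L. \<exists>z zb. is_zzb C z zb \<and> z \<in> beyond_one \<and> zb \<in> neg_axis}"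

definition class_E :: "'n::finite config set" where
  "class_E = confs_L - (class_S \<union> class_T \<union> class_U)"

definition class_E_su :: "'n::finite config set" where
  "class_E_su = {C \<in> class_E. \<exists>z zb. is_zzb C z zb \<and> z \<in> neg_axis \<and> zb \<in> neg_axis}"

definition class_E_st :: "'n::finite config set" where
  "class_E_st = {C \<in> class_E. \<exists>z zb. is_zzb C z zb \<and> z \<in> unit_interval \<and> zb \<in> unit_interval}"

definition class_E_tu :: "'n::finite config set" where
  "class_E_tu = {C \<in> class_E. \<exists>z zb. is_zzb C z zb \<and> z \<in> beyond_one \<and> zb \<in> beyond_one}"

definition class_E_stu :: "'n::finite config set" where
  "class_E_stu = {C \<in> class_E. \<exists>z zb. is_zzb C z zb \<and> zb = cnj z \<and> z \<notin> \<real>}"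


subsection \<open>Crossing numbers\<close>

text \<open>
  \<open>I\<close> is an open interval of the real axis.  On a parameter interval \<open>{a..b}\<close> on which the curve \<open>f\<close>
  meets the real axis at most inside \<open>I\<close>, the curve crosses \<open>I\<close> once from above (up to cancelling
  crossings) iff it starts in the upper and ends in the lower half-plane.
\<close>

definition crosses_from_above :: "complex set \<Rightarrow> (real \<Rightarrow> complex) \<Rightarrow> real \<Rightarrow> real \<Rightarrow> bool" where
  "crosses_from_above I f a b \<longleftrightarrow> f ` {a..b} \<inter> \<real> \<subseteq> I \<and> Im (f a) > 0 \<and> Im (f b) < 0"

definition crosses_from_below :: "complex set \<Rightarrow> (real \<Rightarrow> complex) \<Rightarrow> real \<Rightarrow> real \<Rightarrow> bool" where
  "crosses_from_below I f a b \<longleftrightarrow> f ` {a..b} \<inter> \<real> \<subseteq> I \<and> Im (f a) < 0 \<and> Im (f b) > 0"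

text \<open>
  A merely continuous curve may touch or cross \<open>I\<close> infinitely often.  Its crossings are therefore
  counted along a finite subdivision of \<open>[0, 1]\<close> with cut points off \<open>I\<close>, on each piece of which
  the curve either meets the real axis only inside \<open>I\<close> or does not meet \<open>I\<close>.  If \<open>f\<close> is continuous,
  avoids the end points of \<open>I\<close> and has both of its end points off \<open>I\<close>, such subdivisions exist and
  all give the same count.  If there are only finitely many crossings, then one can take one piece
  for each of them, so that the count is the number of crossings from above minus the number of
  crossings from below.
\<close>

definition net_crossings :: "complex set \<Rightarrow> (real \<Rightarrow> complex) \<Rightarrow> int \<Rightarrow> bool" where
  "net_crossings I f n \<longleftrightarrow>
     (\<exists>(m::nat) s. s 0 = 0 \<and> s m = 1 \<and> (\<forall>i<m. s i < s (Suc i)) \<and>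
        (\<forall>i\<le>m. f (s i) \<notin> I) \<and>
        (\<forall>i<m. f ` {s i..s (Suc i)} \<inter> \<real> \<subseteq> I \<or> f ` {s i..s (Suc i)} \<inter> I = {}) \<and>
        n = int (card {i. i < m \<and> crosses_from_above I f (s i) (s (Suc i))})
          - int (card {i. i < m \<and> crosses_from_below I f (s i) (s (Suc i))}))"

text \<open>
  A path to \<open>C\<close> together with the continuation of \<open>z, zb\<close> along it, labelled by \<open>Im z > 0\<close> at the
  Euclidean starting point (where \<open>zb\<close> is the complex conjugate of \<open>z\<close>).
\<close>

definition path_to :: "'n::finite config \<Rightarrow> (real \<Rightarrow> 'n config) \<Rightarrow>
    (real \<Rightarrow> complex) \<Rightarrow> (real \<Rightarrow> complex) \<Rightarrow> bool" where
  "path_to C \<gamma> z zb \<longleftrightarrow>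
     path \<gamma> \<and> path_image \<gamma> \<subseteq> closure confs \<and>
     \<gamma> 0 \<in> confs_E - Gamma_set \<and> (\<forall>s\<in>{0..<1}. \<gamma> s \<in> confs - Gamma_set) \<and> \<gamma> 1 = C \<and>
     continuous_on {0..1} z \<and> continuous_on {0..1} zb \<and>
     (\<forall>s\<in>{0..1}. is_zzb (\<gamma> s) (z s) (zb s)) \<and> Im (z 0) > 0"

text \<open>
  The total crossing number does not depend on the path.  It is meant to be used only if neither
  \<open>z\<close> nor \<open>zb\<close> lies in \<open>I\<close> at \<open>C\<close>.
\<close>

definition crossing_number :: "complex set \<Rightarrow> 'n::finite config \<Rightarrow> int" where
  "crossing_number I C = (THE N. \<exists>\<gamma> z zb n nb. path_to C \<gamma> z zb \<and>
     net_crossings I z n \<and> net_crossings I zb nb \<and> N = n + nb)"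

definition N_t :: "'n::finite config \<Rightarrow> int" where
  "N_t = crossing_number neg_axis"

definition N_u :: "'n::finite config \<Rightarrow> int" where
  "N_u = crossing_number unit_interval"


subsection \<open>Channel convergence\<close>

text \<open>
  The convergence of a conformal block expansion of the Lorentzian four-point function at a
  configuration in \<open>confs_L\<close> is, by convention, the following kinematical criterion.
\<close>

definition s_channel_convergent :: "'n::finite config \<Rightarrow> bool" where
  "s_channel_convergent C \<longleftrightarrow> (\<forall>z zb. is_zzb C z zb \<longrightarrow> z \<notin> beyond_one \<and> zb \<notin> beyond_one)"

definition t_channel_convergent :: "'n::finite config \<Rightarrow> bool" where
  "t_channel_convergent C \<longleftrightarrow>
     (\<forall>z zb. is_zzb C z zb \<longrightarrow> z \<notin> neg_axis \<and> zb \<notin> neg_axis) \<and> N_t C = 0"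

definition u_channel_convergent :: "'n::finite config \<Rightarrow> bool" where
  "u_channel_convergent C \<longleftrightarrow>
     (\<forall>z zb. is_zzb C z zb \<longrightarrow> z \<notin> unit_interval \<and> zb \<notin> unit_interval) \<and> N_u C = 0"

definition only_s_channel_convergent :: "'n::finite config \<Rightarrow> bool" where
  "only_s_channel_convergent C \<longleftrightarrow>
     s_channel_convergent C \<and> \<not> t_channel_convergent C \<and> \<not> u_channel_convergent C"

end

theory Submission
  imports Defs "HOL-Computational_Algebra.Polynomial"
begin

text \<open>
  Every \<open>x\<^sub>i\<^sub>j\<^sup>2\<close> factorizes as \<open>(\<tau> + i r) (\<tau> - i r)\<close>; on the domain both factors lie in an open half-plane,
  so \<open>log u\<close> has a branch that extends continuously to the Lorentzian boundary, where its imaginary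
  part is a sum of terms \<open>0, \<plusminus> \<pi>\<close> that depend only on the causal ordering.  On the other hand
  \<open>u = z zb\<close>, and the continued phases of \<open>z\<close> and \<open>zb\<close> add up to the sum of their principal phases plus
  \<open>2 \<pi> N\<^sub>t\<close>.  The principal phases cancel or vanish in the classes concerned, so \<open>N\<^sub>t\<close> is a function of the
  causal ordering.  The same argument with \<open>z / (z - 1)\<close> and \<open>u / v\<close> in place of \<open>z\<close> and \<open>u\<close> gives \<open>N\<^sub>u\<close>.

  Admissible paths exist because \<open>\<Gamma>\<close> is the zero set of a polynomial in the squared distances: a
  generic segment that ends at the given configuration meets it finitely often, and on a complexified
  Wick rotation its finitely many zeros can be bypassed.
\<close>

section \<open>Crossings and phases\<close>

text \<open>At every point the two logarithms differ by a multiple of 2 pi i. Distinct such values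
  are at least 2 pi apart, so a continuous difference cannot vary on a connected set.\<close>

lemma complex_logs_same_increment:
  fixes g h :: "'a::topological_space \<Rightarrow> complex"
  assumes "connected S" "continuous_on S g" "continuous_on S h"
    and eq: "\<And>x. x \<in> S \<Longrightarrow> exp (g x) = exp (h x)"
    and "a \<in> S" "b \<in> S"
  shows "g b - g a = h b - h a"
proof -
  have "(\<lambda>x. g x - h x) constant_on S"
  proof (rule continuous_discrete_range_constant[OF \<open>connected S\<close>])
    show "continuous_on S (\<lambda>x. g x - h x)"
      using assms by (intro continuous_intros)
    show "\<exists>e>0. \<forall>y. y \<in> S \<and> g y - h y \<noteq> g x - h x \<longrightarrow> e \<le> norm (g y - h y - (g x - h x))"
      if x: "x \<in> S" for x
    proof (intro exI conjI allI impI)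
      fix y assume y: "y \<in> S \<and> g y - h y \<noteq> g x - h x"
      have "exp (g y - h y) = exp (g x - h x)"
        using eq x y by (simp add: exp_diff)
      then have "\<not> \<bar>Im (g y - h y) - Im (g x - h x)\<bar> < 2 * pi"
        using exp_complex_eqI y by blast
      then show "2 * pi \<le> norm (g y - h y - (g x - h x))"
        using abs_Im_le_cmod[of "g y - h y - (g x - h x)"] by simp
    qed simp
  qed
  then obtain c where "\<And>x. x \<in> S \<Longrightarrow> g x - h x = c"
    by (auto simp: constant_on_def)
  then have "g a - h a = g b - h b"
    using assms by simp
  then show ?thesis
    by (simp add: algebra_simps)
qed

lemma not_in_neg_axis_iff: "z \<noteq> 0 \<Longrightarrow> z \<notin> neg_axis \<longleftrightarrow> z \<notin> \<real>\<^sub>\<le>\<^sub>0"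
  by (auto simp: neg_axis_def nonpos_Reals_def image_iff less_le)

lemma Arg_uminus_upper: "Im z > 0 \<Longrightarrow> Arg (- z) = Arg z - pi"
  and Arg_uminus_lower: "Im z < 0 \<Longrightarrow> Arg (- z) = Arg z + pi"
proof -
  show "Arg (- z) = Arg z - pi" if "Im z > 0"
    using that Arg_minus[of z] Arg_lt_pi[of z] by fastforce
  show "Arg (- z) = Arg z + pi" if "Im z < 0"
    using that Arg_minus[of z] Arg_neg_iff[of z] by fastforce
qed

text \<open>An exponential never vanishes, so \<open>f\<close> stays off the whole branch cut of
  \<open>Ln\<close>. The principal logarithm of \<open>f\<close> is then a continuous logarithm to
  compare with \<open>g\<close>.\<close>

lemma Im_increment_without_neg_axis:
  fixes a b :: real
  assumes "a \<le> b" "continuous_on {a..b} g"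
    and f: "\<And>s. s \<in> {a..b} \<Longrightarrow> f s = exp (g s)"
    and "\<And>s. s \<in> {a..b} \<Longrightarrow> f s \<notin> neg_axis"
  shows "Im (g b) - Im (g a) = Arg (f b) - Arg (f a)"
proof -
  have nz: "f s \<noteq> 0" and "exp (g s) \<notin> \<real>\<^sub>\<le>\<^sub>0" if "s \<in> {a..b}" for s
    using assms(4)[OF that] f[OF that] not_in_neg_axis_iff[of "f s"] by auto
  then have "continuous_on {a..b} (\<lambda>s. Ln (exp (g s)))"
    using assms(2) by (intro continuous_intros) auto
  then have "g b - g a = Ln (exp (g b)) - Ln (exp (g a))"
    using assms by (intro complex_logs_same_increment[of "{a..b}"]) (use nz in \<open>simp_all flip: f\<close>)
  then have "Im (g b - g a) = Im (Ln (f b) - Ln (f a))"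
    using f assms(1) by simp
  then show ?thesis
    using Arg_eq_Im_Ln nz assms(1) by simp
qed

text \<open>\<open>Arg\<close> drops by 2 pi when the curve passes the cut from above and rises by 2
  pi from below; the last term restores the continuous phase. On a piece that meets the real axis
  only on the cut, \<open>Arg (- f)\<close> is continuous and differs from \<open>Arg f\<close> by
  pi, with a sign that depends on the half-plane.\<close>

lemma crossing_sign_piece:
  assumes ab: "a < b" and g: "continuous_on {a..b} g"
    and f: "\<And>s. s \<in> {a..b} \<Longrightarrow> f s = exp (g s)"
    and piece: "f ` {a..b} \<inter> \<real> \<subseteq> neg_axis \<or> f ` {a..b} \<inter> neg_axis = {}"
    and ends: "f a \<notin> neg_axis" "f b \<notin> neg_axis"
  shows "Im (g b) - Im (g a) = Arg (f b) - Arg (f a)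
    + 2 * pi * (of_bool (crosses_from_above neg_axis f a b) - of_bool (crosses_from_below neg_axis f a b))"
  using piece
proof (elim disjE)
  assume no: "f ` {a..b} \<inter> neg_axis = {}"
  have cont: "continuous_on {a..b} (\<lambda>s. Im (f s))"
    using g f by (metis (no_types, lifting) continuous_on_Im continuous_on_cong continuous_on_exp)
  \<comment> \<open>A change of sign of \<open>Im f\<close> forces a real value, by the intermediate
    value theorem. If all real values were negative, the piece would meet the axis that it avoids,
    so it counts as no crossing in either direction.\<close>
  have "\<not> (f ` {a..b} \<inter> \<real> \<subseteq> neg_axis \<and> Im (f a) * Im (f b) < 0)"
  proof
    assume *: "f ` {a..b} \<inter> \<real> \<subseteq> neg_axis \<and> Im (f a) * Im (f b) < 0"
    then consider "Im (f a) \<le> 0" "0 \<le> Im (f b)" | "Im (f b) \<le> 0" "0 \<le> Im (f a)"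
      by (auto simp: mult_less_0_iff)
    then obtain x where x: "a \<le> x" "x \<le> b" "Im (f x) = 0"
      using IVT'[of "\<lambda>s. Im (f s)" a 0 b] IVT2'[of "\<lambda>s. Im (f s)" b 0 a] ab cont
      by cases auto
    then have "f x \<in> f ` {a..b} \<inter> \<real>"
      by (simp add: complex_is_Real_iff)
    then show False
      using * no by blast
  qed
  then have "\<not> crosses_from_above neg_axis f a b" "\<not> crosses_from_below neg_axis f a b"
    by (auto simp: crosses_from_above_def crosses_from_below_def mult_less_0_iff)
  then show ?thesis
    using Im_increment_without_neg_axis[of a b g f] ab g f no by (simp add: disjoint_iff)
next
  assume sub: "f ` {a..b} \<inter> \<real> \<subseteq> neg_axis"
  \<comment> \<open>Rotate by \<open>pi\<close>: the curve \<open>- f\<close> avoids the negative axis.\<close>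
  have "- f s \<notin> neg_axis" if "s \<in> {a..b}" for s
  proof
    assume "- f s \<in> neg_axis"
    then obtain r where r: "r < 0" "- f s = of_real r"
      by (auto simp: neg_axis_def)
    then have "f s = of_real (- r)"
      by (metis add.inverse_inverse of_real_minus)
    then have "f s \<in> neg_axis"
      using that sub Reals_of_real by (metis IntI image_eqI subsetD)
    then show False
      using r \<open>f s = of_real (- r)\<close> by (auto simp: neg_axis_def simp flip: of_real_minus)
  qed
  \<comment> \<open>\<open>g + \<i> * pi\<close> is a continuous logarithm of \<open>- f\<close>;
    the added constant drops out of the increment.\<close>
  then have *: "Im (g b + \<i> * pi) - Im (g a + \<i> * pi) = Arg (- f b) - Arg (- f a)"
    using ab g f
    by (intro Im_increment_without_neg_axis[of a b "\<lambda>s. g s + \<i> * pi" "\<lambda>s. - f s"])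
      (auto intro!: continuous_intros simp: exp_add)
  have "f a \<in> f ` {a..b}" "f b \<in> f ` {a..b}"
    using ab by simp_all
  then have "f a \<notin> \<real>" "f b \<notin> \<real>"
    using sub ends by blast+
  then have "Im (f a) \<noteq> 0" "Im (f b) \<noteq> 0"
    by (auto simp: complex_is_Real_iff)
  then consider "Im (f a) > 0" "Im (f b) > 0" | "Im (f a) < 0" "Im (f b) < 0"
    | "Im (f a) > 0" "Im (f b) < 0" | "Im (f a) < 0" "Im (f b) > 0"
    by linarith
  then show ?thesis
    using * sub
    by cases (simp_all add: crosses_from_above_def crosses_from_below_def
        Arg_uminus_upper Arg_uminus_lower)
qed

section \<open>Counting crossings along subdivisions\<close>

lemma subdivision_bounds:
  fixes s :: "nat \<Rightarrow> real"
  assumes "\<And>i. i < m \<Longrightarrow> s i < s (Suc i)" and "i \<le> m"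
  shows "s 0 \<le> s i" "s i \<le> s m"
proof -
  show "s 0 \<le> s i"
    using \<open>i \<le> m\<close>
  proof (induction i)
    case (Suc i)
    then show ?case using assms(1)[of i] by simp
  qed simp
  show "s i \<le> s m"
    using \<open>i \<le> m\<close>
  proof (induction rule: inc_induct)
    case (step n)
    then show ?case using assms(1)[of n] by simp
  qed simp
qed

text \<open>Summing \<open>crossing_sign_piece\<close> over the subdivision, both the continuous and
  the principal phases telescope, and 2 pi remains for each signed crossing.\<close>

lemma net_crossings_neg_axis_Arg:
  assumes g: "continuous_on {0..1} g" and f: "\<And>s. s \<in> {0..1} \<Longrightarrow> f s = exp (g s)"
    and "net_crossings neg_axis f n"
  shows "Im (g 1) - Im (g 0) = Arg (f 1) - Arg (f 0) + 2 * pi * of_int n"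
proof -
  obtain m s where s: "s 0 = 0" "s m = 1" "\<And>i. i < m \<Longrightarrow> s i < s (Suc i)"
    "\<And>i. i \<le> m \<Longrightarrow> f (s i) \<notin> neg_axis"
    "\<And>i. i < m \<Longrightarrow> f ` {s i..s (Suc i)} \<inter> \<real> \<subseteq> neg_axis \<or> f ` {s i..s (Suc i)} \<inter> neg_axis = {}"
    and n: "n = int (card {i. i < m \<and> crosses_from_above neg_axis f (s i) (s (Suc i))})
          - int (card {i. i < m \<and> crosses_from_below neg_axis f (s i) (s (Suc i))})"
    using assms(3) unfolding net_crossings_def by blast
  have s01: "{s i..s (Suc i)} \<subseteq> {0..1}" if "i < m" for i
    using subdivision_bounds[of m s i] subdivision_bounds[of m s "Suc i"] that s by auto
  define A where "A i = crosses_from_above neg_axis f (s i) (s (Suc i))" for i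
  define B where "B i = crosses_from_below neg_axis f (s i) (s (Suc i))" for i
  have card: "real (card {i. i < m \<and> P i}) = (\<Sum>i<m. of_bool (P i))" for P
    by (simp add: sum.If_cases of_bool_def Int_def)
  have "Im (g 1) - Im (g 0) = (\<Sum>i<m. Im (g (s (Suc i))) - Im (g (s i)))"
    using s by (simp add: sum_lessThan_telescope[of "\<lambda>i. Im (g (s i))"])
  also have "\<dots> = (\<Sum>i<m. (Arg (f (s (Suc i))) - Arg (f (s i))) + 2 * pi * (of_bool (A i) - of_bool (B i)))"
    unfolding A_def B_def
  proof (intro sum.cong refl crossing_sign_piece)
    fix i assume "i \<in> {..<m}"
    then have i: "i < m" by simp
    show "continuous_on {s i..s (Suc i)} g"
      using continuous_on_subset[OF g s01[OF i]] .
    show "f r = exp (g r)" if "r \<in> {s i..s (Suc i)}" for r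
      using f s01[OF i] that by blast
    show "s i < s (Suc i)" "f (s i) \<notin> neg_axis" "f (s (Suc i)) \<notin> neg_axis"
      "f ` {s i..s (Suc i)} \<inter> \<real> \<subseteq> neg_axis \<or> f ` {s i..s (Suc i)} \<inter> neg_axis = {}"
      using s i by auto
  qed
  also have "\<dots> = Arg (f 1) - Arg (f 0) + 2 * pi * of_int n"
    using s unfolding n A_def[symmetric] B_def[symmetric]
    unfolding sum.distrib sum_lessThan_telescope[of "\<lambda>i. Arg (f (s i))"]
    by (simp add: sum_subtractf card flip: sum_distrib_left)
  finally show ?thesis .
qed

text \<open>Along the curve the closed sets \<open>K\<close> and \<open>L\<close> stand in for
  \<open>I\<close> and for the rest of the real axis. Their preimages are disjoint compact subsets
  of [0, 1], hence a positive distance apart, and a parameter interval shorter than this distance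
  cannot meet both.\<close>

lemma net_crossings_exists:
  assumes f: "continuous_on {0..1} f"
    and I: "I \<subseteq> \<real>" "closed K" "closed L" "\<And>s. s \<in> {0..1} \<Longrightarrow> f s \<in> I \<longleftrightarrow> f s \<in> K"
      "\<And>s. s \<in> {0..1} \<Longrightarrow> f s \<in> \<real> - I \<longleftrightarrow> f s \<in> L"
    and ends: "f 0 \<notin> I" "f 1 \<notin> I"
  shows "\<exists>n. net_crossings I f n"
proof -
  define P where "P a b \<longleftrightarrow> f ` {a..b} \<inter> \<real> \<subseteq> I" for a b
  define Q where "Q a b \<longleftrightarrow> f ` {a..b} \<inter> I = {}" for a b
  \<comment> \<open>\<open>R\<close> relates the ends of an admissible piece, so a chain from 0 to 1
    is a subdivision as \<open>net_crossings\<close> demands.\<close>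
  define R where "R a b \<longleftrightarrow> a < b \<and> f b \<notin> I \<and> (P a b \<or> Q a b)" for a b
  have "compact ({0..1} \<inter> f -` K)" "compact ({0..1} \<inter> f -` L)"
    using continuous_closed_preimage[OF f] I by (auto simp: compact_eq_bounded_closed bounded_Int)
  moreover have "({0..1} \<inter> f -` K) \<inter> ({0..1} \<inter> f -` L) = {}"
    using I(4,5) by blast
  ultimately obtain d where d: "d > 0"
    "\<And>x y. x \<in> {0..1} \<inter> f -` K \<Longrightarrow> y \<in> {0..1} \<inter> f -` L \<Longrightarrow> d \<le> dist x y"
    using separate_compact_closed[of "{0..1} \<inter> f -` K" "{0..1} \<inter> f -` L"] compact_imp_closed by metis
  obtain N :: nat where N: "N > 0" "1 / real N < d"
    using d(1) by (metis inverse_eq_divide reals_Archimedean zero_less_Suc)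
  have grid: "P a b \<or> Q a b" if "0 \<le> a" "b \<le> 1" "b - a < d" for a b
  proof (rule ccontr)
    assume "\<not> (P a b \<or> Q a b)"
    then obtain x y where "x \<in> {a..b}" "y \<in> {a..b}" "f x \<in> I" "f y \<in> \<real> - I"
      unfolding P_def Q_def by blast
    then show False
      using d(2)[of x y] I(4,5) that by (auto simp: dist_real_def)
  qed
  \<comment> \<open>A grid point on \<open>I\<close> cannot be a cut point. \<open>p\<close> is the
    last cut point so far; if it lags behind the grid point, the pending piece has met the real axis
    only inside \<open>I\<close> and can still be extended.\<close>
  have "\<exists>p. R\<^sup>*\<^sup>* 0 p \<and> 0 \<le> p \<and> p \<le> real k / N \<and> f p \<notin> I \<and>
      (p = real k / N \<or> f (real k / N) \<in> I \<and> P p (real k / N))" if "k \<le> N" for k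
    using that
  proof (induction k)
    case 0
    then show ?case using ends by auto
  next
    case (Suc k)
    define a b where "a = real k / N" and "b = real (Suc k) / N"
    have ab: "0 \<le> a" "a < b" "b \<le> 1" "b - a < d"
      using N Suc.prems by (auto simp: a_def b_def field_simps)
    obtain p where p: "R\<^sup>*\<^sup>* 0 p" "0 \<le> p" "p \<le> a" "f p \<notin> I" "p = a \<or> f a \<in> I \<and> P p a"
      using Suc unfolding a_def by auto
    have pb: "(P p b \<or> Q p b) \<and> (f b \<in> I \<longrightarrow> P p b)"
    proof (cases "p = a")
      case True
      then show ?thesis
        using grid[of p b] ab image_eqI[of "f b" f b "{p..b}"] by (auto simp: Q_def disjoint_iff)
    next
      case False
      \<comment> \<open>The curve is on \<open>I\<close> at \<open>a\<close>, so the short interval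
        that follows cannot miss \<open>I\<close> and must be of the kind that extends the pending
        piece.\<close>
      then have "P a b"
        using grid[of a b] p ab image_eqI[of "f a" f a "{a..b}"] by (auto simp: Q_def disjoint_iff)
      moreover have "{p..b} = {p..a} \<union> {a..b}"
        using p ab by auto
      ultimately have "P p b"
        using False p by (auto simp: P_def image_Un)
      then show ?thesis by simp
    qed
    show ?case
    proof (cases "f b \<in> I")
      case True
      then show ?thesis
        using p pb ab unfolding b_def[symmetric] by (intro exI[of _ p]) auto
    next
      case False
      then have "R p b"
        using p pb ab by (auto simp: R_def)
      then show ?thesis
        using p ab False unfolding b_def[symmetric] by (intro exI[of _ b]) auto
    qed
  qed
  from this[of N] have "R\<^sup>*\<^sup>* 0 1"
    using N ends by auto
  then obtain m s where s: "s 0 = 0" "s m = 1" "\<And>i. i < m \<Longrightarrow> R (s i) (s (Suc i))"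
    by (auto dest!: rtranclp_imp_relpowp simp: relpowp_fun_conv)
  then have "f (s i) \<notin> I" if "i \<le> m" for i
    using that ends(1) by (cases i) (auto simp: R_def)
  with s show ?thesis
    unfolding net_crossings_def R_def P_def Q_def
    by (intro exI[of _ "int (card {i. i < m \<and> crosses_from_above I f (s i) (s (Suc i))})
          - int (card {i. i < m \<and> crosses_from_below I f (s i) (s (Suc i))})"] exI[of _ m] exI[of _ s]) auto
qed

text \<open>The two closed half-lines of the real axis share only 0, which the curve avoids.\<close>

lemma net_crossings_neg_axis_exists:
  assumes "continuous_on {0..1} f" "\<And>s. s \<in> {0..1} \<Longrightarrow> f s \<noteq> 0" "f 0 \<notin> neg_axis" "f 1 \<notin> neg_axis"
  shows "\<exists>n. net_crossings neg_axis f n"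
proof (rule net_crossings_exists[where K = "\<real>\<^sub>\<le>\<^sub>0" and L = "\<real>\<^sub>\<ge>\<^sub>0"])
  show "f s \<in> \<real> - neg_axis \<longleftrightarrow> f s \<in> \<real>\<^sub>\<ge>\<^sub>0" if "s \<in> {0..1}" for s
    using assms(2)[OF that]
    by (auto simp: neg_axis_def nonneg_Reals_def Reals_def image_iff not_less)
qed (use assms not_in_neg_axis_iff in \<open>auto simp: neg_axis_def\<close>)

text \<open>
  Crossings of \<open>(0, 1)\<close> reduce to crossings of the negative axis, with \<open>u / v\<close> in place of \<open>u\<close>, by this
  involution of the plane without \<open>1\<close>.
\<close>

definition moebius_swap :: "complex \<Rightarrow> complex" where
  "moebius_swap z = z / (z - 1)"

lemma Im_moebius_swap: "Im (moebius_swap z) = - Im z / (cmod (z - 1))\<^sup>2"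
  by (simp add: moebius_swap_def Im_divide cmod_power2 algebra_simps)

lemma moebius_swap_real: "z \<noteq> 1 \<Longrightarrow> moebius_swap z \<in> \<real> \<longleftrightarrow> z \<in> \<real>"
  using Im_moebius_swap by (simp add: complex_is_Real_iff)

lemma moebius_swap_involution: "z \<noteq> 1 \<Longrightarrow> moebius_swap (moebius_swap z) = z"
  by (simp add: moebius_swap_def field_simps)

lemma moebius_swap_of_real: "moebius_swap (of_real r) = of_real (r / (r - 1))"
  by (simp add: moebius_swap_def)

lemma moebius_swap_cnj: "moebius_swap (cnj z) = cnj (moebius_swap z)"
  by (simp add: moebius_swap_def)

lemma moebius_swap_neg_axis: "z \<noteq> 1 \<Longrightarrow> moebius_swap z \<in> neg_axis \<longleftrightarrow> z \<in> unit_interval"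
proof
  assume "moebius_swap z \<in> neg_axis" "z \<noteq> 1"
  then obtain r where "r < 0" "z = moebius_swap (of_real r)"
    by (metis moebius_swap_involution imageE lessThan_iff neg_axis_def)
  then show "z \<in> unit_interval"
    unfolding unit_interval_def by (auto simp: moebius_swap_of_real divide_simps simp del: of_real_divide intro!: imageI)
next
  assume "z \<in> unit_interval"
  then show "moebius_swap z \<in> neg_axis"
    unfolding neg_axis_def unit_interval_def
    by (auto simp: moebius_swap_of_real field_simps simp del: of_real_divide intro!: imageI)
qed

text \<open>The same subdivision serves both curves: the map preserves the real axis and carries (0,
  1) to the negative axis. It exchanges the two half-planes, so crossings from above become
  crossings from below, whence the minus sign.\<close>

lemma net_crossings_moebius_swap:
  assumes "\<And>s. s \<in> {0..1} \<Longrightarrow> f s \<noteq> 1" and "net_crossings unit_interval f n"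
  shows "net_crossings neg_axis (\<lambda>s. moebius_swap (f s)) (- n)"
proof -
  define w where "w s = moebius_swap (f s)" for s
  obtain m s where s: "s 0 = 0" "s m = 1" "\<And>i. i < m \<Longrightarrow> s i < s (Suc i)"
    "\<And>i. i \<le> m \<Longrightarrow> f (s i) \<notin> unit_interval"
    "\<And>i. i < m \<Longrightarrow> f ` {s i..s (Suc i)} \<inter> \<real> \<subseteq> unit_interval \<or> f ` {s i..s (Suc i)} \<inter> unit_interval = {}"
    and n: "n = int (card {i. i < m \<and> crosses_from_above unit_interval f (s i) (s (Suc i))})
          - int (card {i. i < m \<and> crosses_from_below unit_interval f (s i) (s (Suc i))})"
    using assms(2) unfolding net_crossings_def by blast
  have s01: "{s i..s (Suc i)} \<subseteq> {0..1}" if "i < m" for i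
    using subdivision_bounds[of m s i] subdivision_bounds[of m s "Suc i"] that s by auto
  have s01': "s i \<in> {0..1}" if "i \<le> m" for i
    using subdivision_bounds[of m s i] that s by auto
  have w: "w s \<in> \<real> \<longleftrightarrow> f s \<in> \<real>" "w s \<in> neg_axis \<longleftrightarrow> f s \<in> unit_interval"
    "Im (w s) > 0 \<longleftrightarrow> Im (f s) < 0" "Im (w s) < 0 \<longleftrightarrow> Im (f s) > 0" if "s \<in> {0..1}" for s
    using assms(1)[OF that]
    by (auto simp: w_def moebius_swap_real moebius_swap_neg_axis Im_moebius_swap
        zero_less_divide_iff divide_less_0_iff)
  have real_sub: "w ` {s i..s (Suc i)} \<inter> \<real> \<subseteq> neg_axis \<longleftrightarrow> f ` {s i..s (Suc i)} \<inter> \<real> \<subseteq> unit_interval"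
    and disj: "w ` {s i..s (Suc i)} \<inter> neg_axis = {} \<longleftrightarrow> f ` {s i..s (Suc i)} \<inter> unit_interval = {}"
    if "i < m" for i
    using w(1,2) s01[OF that] by (auto simp: subset_iff disjoint_iff)
  have "crosses_from_above neg_axis w (s i) (s (Suc i)) = crosses_from_below unit_interval f (s i) (s (Suc i))"
    "crosses_from_below neg_axis w (s i) (s (Suc i)) = crosses_from_above unit_interval f (s i) (s (Suc i))"
    if "i < m" for i
    unfolding crosses_from_above_def crosses_from_below_def real_sub[OF that]
    using that w(3,4)[OF s01'[of i]] w(3,4)[OF s01'[of "Suc i"]] by auto
  then have "- n = int (card {i. i < m \<and> crosses_from_above neg_axis w (s i) (s (Suc i))})
          - int (card {i. i < m \<and> crosses_from_below neg_axis w (s i) (s (Suc i))})"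
    unfolding n by (simp cong: conj_cong)
  then show ?thesis
    unfolding net_crossings_def w_def[symmetric]
    using s s01' w(2) real_sub disj by (intro exI[of _ m] exI[of _ s]) auto
qed

lemma net_crossings_unit_interval_exists:
  assumes "continuous_on {0..1} f" "\<And>s. s \<in> {0..1} \<Longrightarrow> f s \<noteq> 0" "\<And>s. s \<in> {0..1} \<Longrightarrow> f s \<noteq> 1"
    "f 0 \<notin> unit_interval" "f 1 \<notin> unit_interval"
  shows "\<exists>n. net_crossings unit_interval f n"
proof (rule net_crossings_exists[where K = "of_real ` {0..1}" and L = "of_real ` ({..0} \<union> {1..})"])
  show "f s \<in> unit_interval \<longleftrightarrow> f s \<in> of_real ` {0..1}" if "s \<in> {0..1}" for s
    using assms(2,3)[OF that] by (auto simp: unit_interval_def image_iff less_le)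
  show "f s \<in> \<real> - unit_interval \<longleftrightarrow> f s \<in> of_real ` ({..0} \<union> {1..})" if "s \<in> {0..1}" for s
    by (auto simp: unit_interval_def image_iff Reals_def not_less)
  show "closed (of_real ` {0..1} :: complex set)"
    by (intro compact_imp_closed compact_continuous_image continuous_intros) auto
  show "closed (of_real ` ({..0} \<union> {1..}) :: complex set)"
    by (intro closed_injective_linear_image[OF closed_Un])
       (auto intro!: bounded_linear.linear bounded_linear_of_real inj_onI)
qed (use assms in \<open>auto simp: unit_interval_def\<close>)

text \<open>The sum of continuous logarithms of \<open>z\<close> and \<open>zb\<close> and the given
  \<open>l\<close> are both logarithms of \<open>z * zb\<close>, so they have the same increment. At
  the start the principal phases of the nonreal conjugate pair cancel.\<close>

lemma net_crossings_pair:
  assumes z: "continuous_on {0..1} z" "continuous_on {0..1} zb" "continuous_on {0..1} l"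
    and zl: "\<And>s. s \<in> {0..1} \<Longrightarrow> z s * zb s = exp (l s)"
    and start: "zb 0 = cnj (z 0)" "z 0 \<notin> \<real>" "Im (l 0) = 0"
    and n: "net_crossings neg_axis z n" "net_crossings neg_axis zb nb"
  shows "2 * pi * of_int (n + nb) = Im (l 1) - Arg (z 1) - Arg (zb 1)"
proof -
  have "z s \<noteq> 0" "zb s \<noteq> 0" if "s \<in> {0..1}" for s
    using zl[OF that] by auto
  then obtain g gb where g: "continuous_on {0..1} g" "\<And>s. s \<in> {0..1} \<Longrightarrow> z s = exp (g s)"
    and gb: "continuous_on {0..1} gb" "\<And>s. s \<in> {0..1} \<Longrightarrow> zb s = exp (gb s)"
    using continuous_logarithm_on_contractible[OF z(1)] continuous_logarithm_on_contractible[OF z(2)]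
      convex_imp_contractible by (metis convex_real_interval(5))
  have "(g 1 + gb 1) - (g 0 + gb 0) = l 1 - l 0"
    using z(3) g gb zl
    by (intro complex_logs_same_increment[of "{0..1::real}" "\<lambda>s. g s + gb s"])
       (auto intro!: continuous_intros simp: exp_add)
  then have "(Im (g 1) - Im (g 0)) + (Im (gb 1) - Im (gb 0)) = Im (l 1)"
    using start(3) by (simp add: complex_eq_iff)
  then show ?thesis
    using net_crossings_neg_axis_Arg[OF g n(1)] net_crossings_neg_axis_Arg[OF gb n(2)] start
    by (simp add: Arg_cnj algebra_simps)
qed

section \<open>Phases of the cross ratios\<close>

text \<open>
  The pairs of labels whose squared distances enter \<open>u\<close> and \<open>v\<close>, oriented so that \<open>Re \<tau>\<close>
  decreases on \<open>confs\<close>.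
\<close>

definition time_pairs :: "(4 \<times> 4) set" where
  "time_pairs = {(1, 2), (3, 4), (1, 3), (2, 4), (1, 4), (2, 3)}"

text \<open>Chosen to contain a whole admissible path, its Lorentzian end point included: real parts
  may coincide as long as no squared distance vanishes.\<close>

definition regular_confs :: "'n::finite config set" where
  "regular_confs = {C. \<forall>(i, j)\<in>time_pairs. Re (tau C i - tau C j) \<ge> 0 \<and> sqdist C i j \<noteq> 0}"

text \<open>\<open>Ln\<close> of the product would jump where the squared distance is negative. On
  \<open>regular_confs\<close>, for pairs in \<open>time_pairs\<close>, each factor is nonzero with
  nonnegative real part, hence off the cut.\<close>

definition log_sqdist :: "'n::finite config \<Rightarrow> 4 \<Rightarrow> 4 \<Rightarrow> complex" where
  "log_sqdist C i j =
     (let r = of_real (norm (space_part C i - space_part C j))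
      in Ln (tau C i - tau C j + \<i> * r) + Ln (tau C i - tau C j - \<i> * r))"

definition log_u :: "'n::finite config \<Rightarrow> complex" where
  "log_u C = log_sqdist C 1 2 + log_sqdist C 3 4 - log_sqdist C 1 3 - log_sqdist C 2 4"

definition log_u_over_v :: "'n::finite config \<Rightarrow> complex" where
  "log_u_over_v C = log_sqdist C 1 2 + log_sqdist C 3 4 - log_sqdist C 1 4 - log_sqdist C 2 3"

lemma sqdist_factor:
  "sqdist C i j = (tau C i - tau C j + \<i> * of_real (norm (space_part C i - space_part C j)))
     * (tau C i - tau C j - \<i> * of_real (norm (space_part C i - space_part C j)))"
  by (simp add: sqdist_def algebra_simps power2_eq_square)

lemma sqdist_nonzero: "Re (tau C i - tau C j) \<noteq> 0 \<Longrightarrow> sqdist C i j \<noteq> 0"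
proof -
  assume "Re (tau C i - tau C j) \<noteq> 0"
  then have "tau C i - tau C j + \<i> * of_real r \<noteq> 0" "tau C i - tau C j - \<i> * of_real r \<noteq> 0" for r
    by (simp_all add: complex_eq_iff)
  then show ?thesis
    unfolding sqdist_factor mult_eq_0_iff by blast
qed

lemma exp_log_sqdist: "sqdist C i j \<noteq> 0 \<Longrightarrow> exp (log_sqdist C i j) = sqdist C i j"
  by (simp add: log_sqdist_def Let_def exp_add sqdist_factor)

lemma confs_time_pairs:
  assumes "C \<in> confs" "(i, j) \<in> time_pairs"
  shows "Re (tau C i - tau C j) > 0"
  using assms by (auto simp: confs_def time_pairs_def)

lemma confs_subset_regular: "confs \<subseteq> regular_confs"
  using confs_time_pairs sqdist_nonzero by (force simp: regular_confs_def)

lemma confs_L_subset_regular: "confs_L \<subseteq> regular_confs"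
  by (auto simp: confs_L_def regular_confs_def time_pairs_def)

lemma regular_sqdist_nonzero:
  assumes "C \<in> regular_confs"
  shows "sqdist C 1 2 \<noteq> 0" "sqdist C 3 4 \<noteq> 0" "sqdist C 1 3 \<noteq> 0" "sqdist C 2 4 \<noteq> 0"
    "sqdist C 1 4 \<noteq> 0" "sqdist C 2 3 \<noteq> 0"
  using assms by (auto simp: regular_confs_def time_pairs_def)

lemma exp_log_u: "C \<in> regular_confs \<Longrightarrow> exp (log_u C) = cross_u C"
  by (simp add: log_u_def exp_add exp_diff exp_log_sqdist regular_sqdist_nonzero cross_u_def)

lemma exp_log_u_over_v: "C \<in> regular_confs \<Longrightarrow> exp (log_u_over_v C) = cross_u C / cross_v C"
  by (simp add: log_u_over_v_def exp_add exp_diff exp_log_sqdist regular_sqdist_nonzero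
      cross_u_def cross_v_def)

lemma regular_zzb:
  assumes "C \<in> regular_confs" "is_zzb C z zb"
  shows "z \<noteq> 0" "zb \<noteq> 0" "z \<noteq> 1" "zb \<noteq> 1"
  using assms regular_sqdist_nonzero[OF assms(1)]
  by (auto simp: is_zzb_def cross_u_def cross_v_def)

section \<open>Continuity of the logarithms and their phases at Euclidean and Lorentzian
  points\<close>

lemma continuous_on_tau [continuous_intros]:
  "continuous_on S \<gamma> \<Longrightarrow> continuous_on S (\<lambda>s. tau (\<gamma> s) k)"
  unfolding tau_def by (intro continuous_intros)

lemma continuous_on_space_part [continuous_intros]:
  "continuous_on S \<gamma> \<Longrightarrow> continuous_on S (\<lambda>s. space_part (\<gamma> s) k)"
  unfolding space_part_def by (intro continuous_intros)

lemma continuous_on_sqdist [continuous_intros]: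
  "continuous_on S \<gamma> \<Longrightarrow> continuous_on S (\<lambda>s. sqdist (\<gamma> s) i j)"
  unfolding sqdist_def by (intro continuous_intros)

lemma continuous_on_log_sqdist:
  assumes "continuous_on S \<gamma>"
    and "\<And>s. s \<in> S \<Longrightarrow> Re (tau (\<gamma> s) i - tau (\<gamma> s) j) \<ge> 0 \<and> sqdist (\<gamma> s) i j \<noteq> 0"
  shows "continuous_on S (\<lambda>s. log_sqdist (\<gamma> s) i j)"
  unfolding log_sqdist_def Let_def
proof (intro continuous_intros assms(1))
  fix s assume "s \<in> S"
  from assms(2)[OF this] show
    "tau (\<gamma> s) i - tau (\<gamma> s) j + \<i> * of_real (norm (space_part (\<gamma> s) i - space_part (\<gamma> s) j)) \<notin> \<real>\<^sub>\<le>\<^sub>0"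
    "tau (\<gamma> s) i - tau (\<gamma> s) j - \<i> * of_real (norm (space_part (\<gamma> s) i - space_part (\<gamma> s) j)) \<notin> \<real>\<^sub>\<le>\<^sub>0"
    by (auto simp: sqdist_factor complex_nonpos_Reals_iff complex_eq_iff)
qed

lemma continuous_on_log_u:
  assumes "continuous_on S \<gamma>" "\<gamma> ` S \<subseteq> regular_confs"
  shows "continuous_on S (\<lambda>s. log_u (\<gamma> s))" "continuous_on S (\<lambda>s. log_u_over_v (\<gamma> s))"
  unfolding log_u_def log_u_over_v_def using assms
  by (auto intro!: continuous_on_add continuous_on_diff continuous_on_log_sqdist
      simp: regular_confs_def time_pairs_def image_subset_iff)

text \<open>For real times the two factors are complex conjugates, so their phases cancel. This
  normalizes the phases of u and u / v at the start of a path.\<close>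

lemma Im_log_sqdist_Euclidean:
  assumes "tau C i \<in> \<real>" "tau C j \<in> \<real>" "Re (tau C i - tau C j) > 0"
  shows "Im (log_sqdist C i j) = 0"
proof -
  define w where "w = tau C i - tau C j + \<i> * of_real (norm (space_part C i - space_part C j))"
  have "cnj w = tau C i - tau C j - \<i> * of_real (norm (space_part C i - space_part C j))"
    using assms(1,2) by (simp add: w_def Reals_cnj_iff)
  moreover have "cnj (Ln w) = Ln (cnj w)"
    using assms by (intro cnj_Ln) (auto simp: w_def complex_nonpos_Reals_iff)
  ultimately have "log_sqdist C i j = Ln w + cnj (Ln w)"
    by (simp add: log_sqdist_def Let_def w_def)
  then show ?thesis by simp
qed

text \<open>The factors are i (t + r) and i (t - r), each with phase pi / 2 or - pi / 2. The signs
  are opposite for spacelike separation; for timelike separation both equal the sign of t.\<close>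

lemma Im_log_sqdist_Lorentzian:
  assumes "Re (tau C i) = 0" "Re (tau C j) = 0" "sqdist C i j \<noteq> 0"
  shows "Im (log_sqdist C i j) =
    (if causally_before C j i then pi else if causally_before C i j then - pi else 0)"
proof -
  define r t where "r = norm (space_part C i - space_part C j)" and "t = Im (tau C i) - Im (tau C j)"
  have r: "r \<ge> 0" "norm (space_part C j - space_part C i) = r"
    by (simp_all add: r_def norm_minus_commute)
  have w: "tau C i - tau C j + \<i> * of_real r = \<i> * of_real (t + r)"
    "tau C i - tau C j - \<i> * of_real r = \<i> * of_real (t - r)"
    using assms by (auto simp: t_def complex_eq_iff)
  then have nz: "t + r \<noteq> 0" "t - r \<noteq> 0"
    using assms(3) unfolding sqdist_factor r_def[symmetric] w
    by (auto simp del: of_real_add of_real_diff)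
  have L: "Im (Ln (\<i> * of_real x)) = sgn x * (pi / 2)" if "x \<noteq> 0" for x :: real
    using that Im_Ln_eq_pi_half[of "\<i> * of_real x"] by (cases "x > 0") auto
  have "Im (log_sqdist C i j) = sgn (t + r) * (pi / 2) + sgn (t - r) * (pi / 2)"
    unfolding log_sqdist_def Let_def r_def[symmetric] w using nz
    by (simp add: L del: of_real_add of_real_diff)
  moreover have "causally_before C j i \<longleftrightarrow> t > r" "causally_before C i j \<longleftrightarrow> - t > r"
    using r by (auto simp: causally_before_def t_def r_def)
  ultimately show ?thesis
    using nz r(1) by (auto simp: sgn_if)
qed

lemma Im_log_u_causal:
  assumes "C \<in> confs_L_ordered \<alpha>" "C' \<in> confs_L_ordered \<alpha>"
  shows "Im (log_u C) = Im (log_u C')" "Im (log_u_over_v C) = Im (log_u_over_v C')"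
proof -
  have "causally_before C i j = causally_before C' i j" for i j
    using assms by (auto simp: confs_L_ordered_def causal_ordering_def)
  moreover have "C \<in> confs_L" "C' \<in> confs_L"
    using assms by (auto simp: confs_L_ordered_def)
  ultimately have "Im (log_sqdist C i j) = Im (log_sqdist C' i j)" if "i \<noteq> j" for i j
    using that by (simp add: Im_log_sqdist_Lorentzian confs_L_def)
  then show "Im (log_u C) = Im (log_u C')" "Im (log_u_over_v C) = Im (log_u_over_v C')"
    by (simp_all add: log_u_def log_u_over_v_def)
qed

text \<open>u and v determine the sum and the product of the pair, so both pairs are the roots of
  one quadratic. Facts about one solution thus transfer to any other.\<close>

lemma is_zzb_unique:
  assumes "is_zzb C z zb" "is_zzb C w wb"
  shows "(w = z \<and> wb = zb) \<or> (w = zb \<and> wb = z)"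
proof -
  have p: "z * zb = w * wb" and s: "z + zb = w + wb"
    using assms unfolding is_zzb_def by (auto simp: algebra_simps)
  have "(w - z) * (w - zb) = w * w - (z + zb) * w + z * zb"
    by (simp add: algebra_simps)
  also have "\<dots> = 0"
    unfolding p s by (simp add: algebra_simps)
  finally show ?thesis
    using s by auto
qed

lemma Euclidean_cross_ratios:
  assumes "C \<in> confs_E"
  shows "sqdist C i j \<in> \<real>" "cross_u C \<in> \<real>" "cross_v C \<in> \<real>"
    "Im (log_u C) = 0" "Im (log_u_over_v C) = 0"
proof -
  have t: "tau C k \<in> \<real>" "C \<in> confs" for k
    using assms by (auto simp: confs_E_def)
  show *: "sqdist C i j \<in> \<real>" for i j
    using t by (simp add: sqdist_def)
  show "cross_u C \<in> \<real>" "cross_v C \<in> \<real>"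
    using * by (simp_all add: cross_u_def cross_v_def)
  have "Im (log_sqdist C i j) = 0" if "(i, j) \<in> time_pairs" for i j
    using confs_time_pairs[OF t(2) that] t(1) by (intro Im_log_sqdist_Euclidean)
  then show "Im (log_u C) = 0" "Im (log_u_over_v C) = 0"
    by (simp_all add: log_u_def log_u_over_v_def time_pairs_def)
qed

text \<open>u and v are real, so the conjugate pair is another solution; by uniqueness conjugation
  permutes the pair, and it cannot fix a nonreal root.\<close>

lemma Euclidean_zzb_cnj:
  assumes "C \<in> confs_E" "is_zzb C z zb" "z \<notin> \<real>"
  shows "zb = cnj z"
proof -
  have "cnj (cross_u C) = cross_u C" "cnj (cross_v C) = cross_v C"
    using Euclidean_cross_ratios(2,3)[OF assms(1)] by (simp_all add: Reals_cnj_iff)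
  then have "is_zzb C (cnj z) (cnj zb)"
    using assms(2) unfolding is_zzb_def by (metis complex_cnj_diff complex_cnj_mult complex_cnj_one)
  from is_zzb_unique[OF assms(2) this] show ?thesis
    using assms(3) by (auto simp: Reals_cnj_iff)
qed

section \<open>Crossing numbers along admissible paths\<close>

lemma path_to_regular:
  assumes "C \<in> confs_L" "path_to C \<gamma> z zb"
  shows "continuous_on {0..1} \<gamma>" "s \<in> {0..1} \<Longrightarrow> \<gamma> s \<in> regular_confs"
    "z 0 \<notin> \<real>" "zb 0 \<notin> \<real>" "zb 0 = cnj (z 0)"
    "s \<in> {0..1} \<Longrightarrow> is_zzb (\<gamma> s) (z s) (zb s)" "is_zzb C (z 1) (zb 1)"
    "s \<in> {0..1} \<Longrightarrow> z s \<notin> {0, 1} \<and> zb s \<notin> {0, 1}"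
proof -
  show "continuous_on {0..1} \<gamma>"
    using assms(2) by (simp add: path_to_def path_def)
  show reg: "\<gamma> s \<in> regular_confs" if "s \<in> {0..1}" for s
  proof (cases "s = 1")
    case True
    then show ?thesis
      using assms confs_L_subset_regular by (auto simp: path_to_def)
  next
    case False
    then have "s \<in> {0..<1}" using that by auto
    then show ?thesis
      using assms(2) confs_subset_regular by (auto simp: path_to_def)
  qed
  show nr: "z 0 \<notin> \<real>"
    using assms(2) by (auto simp: path_to_def complex_is_Real_iff)
  show cnj: "zb 0 = cnj (z 0)"
    using assms(2) nr by (intro Euclidean_zzb_cnj[of "\<gamma> 0"]) (auto simp: path_to_def)
  show "zb 0 \<notin> \<real>"
    using nr unfolding cnj by (simp add: complex_is_Real_iff)
  show zz: "is_zzb (\<gamma> s) (z s) (zb s)" if "s \<in> {0..1}" for s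
    using assms(2) that by (simp add: path_to_def)
  show "is_zzb C (z 1) (zb 1)"
    using zz[of 1] assms(2) by (simp add: path_to_def)
  show "z s \<notin> {0, 1} \<and> zb s \<notin> {0, 1}" if "s \<in> {0..1}" for s
    using regular_zzb[OF reg[OF that] zz[OF that]] by simp
qed

text \<open>The definite description needs existence, supplied by one path with defined counts, and
  uniqueness, which holds because every admissible total equals \<open>x / (2 * pi)\<close>.
  Independence of the path is thereby proved.\<close>

lemma crossing_number_eqI:
  assumes p: "path_to C \<gamma> z zb" and ex: "\<exists>n. net_crossings I z n" "\<exists>n. net_crossings I zb n"
    and eq: "\<And>\<gamma> z zb n nb. path_to C \<gamma> z zb \<Longrightarrow> net_crossings I z n \<Longrightarrow> net_crossings I zb nb \<Longrightarrow>
      2 * pi * of_int (n + nb) = x"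
  shows "2 * pi * of_int (crossing_number I C) = x"
proof -
  define P where "P N \<longleftrightarrow> (\<exists>\<gamma> z zb n nb. path_to C \<gamma> z zb \<and>
      net_crossings I z n \<and> net_crossings I zb nb \<and> N = n + nb)" for N
  have *: "2 * pi * of_int N = x" if "P N" for N
  proof -
    from that obtain \<gamma>' z' zb' n nb where "path_to C \<gamma>' z' zb'" "net_crossings I z' n"
      "net_crossings I zb' nb" "N = n + nb"
      unfolding P_def by (elim exE conjE)
    then show ?thesis
      using eq by (simp only:)
  qed
  have "N = N'" if "P N" "P N'" for N N'
  proof -
    have "2 * pi * of_int N = 2 * pi * of_int N'"
      using *[OF that(1)] *[OF that(2)] by (simp only:)
    then show ?thesis by simp
  qed
  moreover obtain n nb where "net_crossings I z n" "net_crossings I zb nb"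
    using ex by blast
  then have "P (n + nb)"
    unfolding P_def using p by (intro exI conjI) (assumption | rule refl)+
  ultimately have "P (THE N. P N)"
    by (metis the_equality)
  moreover have "(THE N. P N) = crossing_number I C"
    unfolding crossing_number_def P_def ..
  ultimately show ?thesis
    using * by simp
qed

text \<open>
  The total phase of \<open>z * zb = u\<close> is read off in two ways: from the squared distances, and as the
  sum of the principal phases of \<open>z\<close> and \<open>zb\<close> plus \<open>2 \<pi>\<close> per crossing.
\<close>

lemma N_t_eq_phase:
  assumes C: "C \<in> confs_L" and ex: "\<exists>\<gamma> z zb. path_to C \<gamma> z zb"
    and fin: "\<And>z zb. is_zzb C z zb \<Longrightarrow> z \<notin> neg_axis \<and> zb \<notin> neg_axis \<and> Arg z + Arg zb = 0"
  shows "2 * pi * of_int (N_t C) = Im (log_u C)"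
proof -
  obtain \<gamma> z zb where p: "path_to C \<gamma> z zb"
    using ex by blast
  note reg = path_to_regular[OF C p]
  have nonreal: "w \<notin> neg_axis" if "w \<notin> \<real>" for w
    using that by (auto simp: neg_axis_def)
  have cont: "continuous_on {0..1} z" "continuous_on {0..1} zb"
    using p by (simp_all add: path_to_def)
  show ?thesis
    unfolding N_t_def
  proof (rule crossing_number_eqI[OF p])
    show "\<exists>n. net_crossings neg_axis z n" "\<exists>n. net_crossings neg_axis zb n"
      using cont reg(8) nonreal[OF reg(3)] nonreal[OF reg(4)] fin[OF reg(7)]
      by (auto intro!: net_crossings_neg_axis_exists)
  next
    fix \<gamma> z zb n nb
    assume p: "path_to C \<gamma> z zb" and n: "net_crossings neg_axis z n" "net_crossings neg_axis zb nb"
    note reg = path_to_regular[OF C p]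
    have "2 * pi * of_int (n + nb) = Im (log_u (\<gamma> 1)) - Arg (z 1) - Arg (zb 1)"
    proof (rule net_crossings_pair[where l = "\<lambda>s. log_u (\<gamma> s)"])
      show "continuous_on {0..1} (\<lambda>s. log_u (\<gamma> s))"
        using reg(1,2) by (intro continuous_on_log_u) auto
      show "z s * zb s = exp (log_u (\<gamma> s))" if "s \<in> {0..1}" for s
        using reg(2,6)[OF that] by (simp add: exp_log_u is_zzb_def)
      show "Im (log_u (\<gamma> 0)) = 0"
        using p by (intro Euclidean_cross_ratios) (simp add: path_to_def)
    qed (use p n reg(3,5) in \<open>simp_all add: path_to_def\<close>)
    moreover have "\<gamma> 1 = C"
      using p by (simp add: path_to_def)
    ultimately show "2 * pi * of_int (n + nb) = Im (log_u C)"
      using fin[OF reg(7)] by simp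
  qed
qed

text \<open>The product of \<open>moebius_swap z\<close> and \<open>moebius_swap zb\<close> is u /
  v, since the two sign changes in the denominator cancel. The minus sign on the right comes from
  the exchange of the half-planes.\<close>

lemma N_u_eq_phase:
  assumes C: "C \<in> confs_L" and ex: "\<exists>\<gamma> z zb. path_to C \<gamma> z zb"
    and fin: "\<And>z zb. is_zzb C z zb \<Longrightarrow>
      z \<notin> unit_interval \<and> zb \<notin> unit_interval \<and> Arg (moebius_swap z) + Arg (moebius_swap zb) = 0"
  shows "2 * pi * of_int (N_u C) = - Im (log_u_over_v C)"
proof -
  obtain \<gamma> z zb where p: "path_to C \<gamma> z zb"
    using ex by blast
  note reg = path_to_regular[OF C p]
  have nonreal: "w \<notin> unit_interval" if "w \<notin> \<real>" for w
    using that by (auto simp: unit_interval_def)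
  have cont: "continuous_on {0..1} z" "continuous_on {0..1} zb"
    using p by (simp_all add: path_to_def)
  show ?thesis
    unfolding N_u_def
  proof (rule crossing_number_eqI[OF p])
    show "\<exists>n. net_crossings unit_interval z n" "\<exists>n. net_crossings unit_interval zb n"
      using cont reg(8) nonreal[OF reg(3)] nonreal[OF reg(4)] fin[OF reg(7)]
      by (auto intro!: net_crossings_unit_interval_exists)
  next
    fix \<gamma> z zb n nb
    assume p: "path_to C \<gamma> z zb"
      and n: "net_crossings unit_interval z n" "net_crossings unit_interval zb nb"
    note reg = path_to_regular[OF C p]
    have ne1: "z s \<noteq> 1" "zb s \<noteq> 1" if "s \<in> {0..1}" for s
      using reg(8)[OF that] by simp_all
    have cont: "continuous_on {0..1} z" "continuous_on {0..1} zb"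
      using p by (simp_all add: path_to_def)
    have "2 * pi * of_int (- n + - nb) =
        Im (log_u_over_v (\<gamma> 1)) - Arg (moebius_swap (z 1)) - Arg (moebius_swap (zb 1))"
    proof (rule net_crossings_pair[where l = "\<lambda>s. log_u_over_v (\<gamma> s)"])
      show "continuous_on {0..1} (\<lambda>s. moebius_swap (z s))" "continuous_on {0..1} (\<lambda>s. moebius_swap (zb s))"
        unfolding moebius_swap_def using cont ne1 by (auto intro!: continuous_intros)
      show "continuous_on {0..1} (\<lambda>s. log_u_over_v (\<gamma> s))"
        using reg(1,2) by (intro continuous_on_log_u) auto
      show "moebius_swap (z s) * moebius_swap (zb s) = exp (log_u_over_v (\<gamma> s))" if "s \<in> {0..1}" for s
      proof -
        have "exp (log_u_over_v (\<gamma> s)) = (z s * zb s) / ((1 - z s) * (1 - zb s))"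
          using reg(2,6)[OF that] by (simp add: exp_log_u_over_v is_zzb_def)
        moreover have "(1 - z s) * (1 - zb s) = (z s - 1) * (zb s - 1)"
          by (simp add: algebra_simps)
        ultimately show ?thesis
          by (simp add: moebius_swap_def)
      qed
      show "Im (log_u_over_v (\<gamma> 0)) = 0"
        using p by (intro Euclidean_cross_ratios) (simp add: path_to_def)
      show "moebius_swap (zb 0) = cnj (moebius_swap (z 0))"
        using reg(5) by (simp add: moebius_swap_cnj)
      show "moebius_swap (z 0) \<notin> \<real>"
        using reg(3) ne1(1)[of 0] by (simp add: moebius_swap_real)
    qed (intro net_crossings_moebius_swap n ne1; assumption)+
    moreover have "\<gamma> 1 = C"
      using p by (simp add: path_to_def)
    ultimately show "2 * pi * of_int (n + nb) = - Im (log_u_over_v C)"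
      using fin[OF reg(7)] by (simp add: algebra_simps)
  qed
qed

section \<open>Paths that avoid coinciding z and zb\<close>

text \<open>The Kallen triangle function of the three products of opposite squared distances. It is
  the discriminant \<open>discr\<close> with denominators cleared, hence a polynomial in the squared
  distances.\<close>

definition kallen :: "'n::finite config \<Rightarrow> complex" where
  "kallen C = (sqdist C 1 3 * sqdist C 2 4 + sqdist C 1 2 * sqdist C 3 4 - sqdist C 1 4 * sqdist C 2 3)\<^sup>2
     - 4 * (sqdist C 1 2 * sqdist C 3 4) * (sqdist C 1 3 * sqdist C 2 4)"

text \<open>The discriminant of X^2 - (1 + u - v) X + u, the quadratic with roots z and zb.\<close>

definition discr :: "'n::finite config \<Rightarrow> complex" where
  "discr C = (1 + cross_u C - cross_v C)\<^sup>2 - 4 * cross_u C"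

lemma discr_kallen:
  assumes "C \<in> regular_confs"
  shows "discr C = kallen C / (sqdist C 1 3 * sqdist C 2 4)\<^sup>2"
proof -
  define A B D where "A = sqdist C 1 3 * sqdist C 2 4" and "B = sqdist C 1 2 * sqdist C 3 4"
    and "D = sqdist C 1 4 * sqdist C 2 3"
  have "A \<noteq> 0"
    using regular_sqdist_nonzero[OF assms] by (simp add: A_def)
  moreover have "discr C = (1 + B / A - D / A)\<^sup>2 - 4 * (B / A)"
    "kallen C = (A + B - D)\<^sup>2 - 4 * B * A"
    by (simp_all add: discr_def kallen_def cross_u_def cross_v_def A_def B_def D_def)
  moreover have "((1 + B / A - D / A)\<^sup>2 - 4 * (B / A)) * A\<^sup>2 = ((1 + B / A - D / A) * A)\<^sup>2 - 4 * (B / A * A) * A"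
    by (simp add: power2_eq_square algebra_simps)
  moreover have "(1 + B / A - D / A) * A = A + B - D" "B / A * A = B"
    using \<open>A \<noteq> 0\<close> by (simp_all add: algebra_simps)
  ultimately show ?thesis
    unfolding A_def[symmetric] by (simp add: nonzero_eq_divide_eq)
qed

lemma is_zzb_discr: "is_zzb C z zb \<Longrightarrow> discr C = (z - zb)\<^sup>2"
proof -
  assume "is_zzb C z zb"
  then have uv: "cross_u C = z * zb" "cross_v C = (1 - z) * (1 - zb)"
    by (simp_all add: is_zzb_def)
  show ?thesis
    unfolding discr_def uv by (simp add: power2_eq_square algebra_simps)
qed

lemma is_zzb_sqrt:
  assumes "q\<^sup>2 = discr C"
  shows "is_zzb C ((1 + cross_u C - cross_v C + q) / 2) ((1 + cross_u C - cross_v C - q) / 2)"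
proof -
  have "q * q = (1 + cross_u C - cross_v C) * (1 + cross_u C - cross_v C) - 4 * cross_u C"
    using assms by (simp add: discr_def power2_eq_square)
  then show ?thesis
    by (simp add: is_zzb_def field_simps)
qed

lemma kallen_not_Gamma:
  assumes "C \<in> confs" "kallen C \<noteq> 0"
  shows "C \<notin> Gamma_set"
proof -
  have "discr C \<noteq> 0"
    using assms discr_kallen[of C] regular_sqdist_nonzero[of C] confs_subset_regular by auto
  then show ?thesis
    using is_zzb_discr by (fastforce simp: Gamma_set_def)
qed

text \<open>
  Cauchy-Schwarz for the differences of the images of \<open>a, b, c\<close> under the inversion centred at \<open>d\<close>,
  with denominators cleared.
\<close>

lemma Euclidean_kallen_nonpos:
  fixes a b c d :: "'a::real_inner"
  assumes "c \<noteq> d"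
  shows "((norm (a - c))\<^sup>2 * (norm (b - d))\<^sup>2 + (norm (a - b))\<^sup>2 * (norm (c - d))\<^sup>2
      - (norm (a - d))\<^sup>2 * (norm (b - c))\<^sup>2)\<^sup>2
    \<le> 4 * ((norm (a - b))\<^sup>2 * (norm (c - d))\<^sup>2) * ((norm (a - c))\<^sup>2 * (norm (b - d))\<^sup>2)"
proof -
  define x y w where "x = a - d" and "y = b - d" and "w = c - d"
  define X Y Z where "X = x \<bullet> x" and "Y = y \<bullet> y" and "Z = w \<bullet> w"
  define e f g where "e = x \<bullet> y" and "f = y \<bullet> w" and "g = x \<bullet> w"
  have diffs: "a - c = x - w" "b - d = y" "a - b = x - y" "c - d = w" "a - d = x" "b - c = y - w"
    by (simp_all add: x_def y_def w_def)
  have inners: "x \<bullet> x = X" "y \<bullet> y = Y" "w \<bullet> w = Z" "x \<bullet> y = e" "y \<bullet> x = e" "y \<bullet> w = f" "w \<bullet> y = f"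
    "x \<bullet> w = g" "w \<bullet> x = g"
    by (simp_all add: X_def Y_def Z_def e_def f_def g_def inner_commute)
  have norms: "(norm (x - w))\<^sup>2 = X + Z - 2 * g" "(norm (x - y))\<^sup>2 = X + Y - 2 * e"
    "(norm (y - w))\<^sup>2 = Y + Z - 2 * f" "(norm x)\<^sup>2 = X" "(norm y)\<^sup>2 = Y" "(norm w)\<^sup>2 = Z"
    by (simp_all add: power2_norm_eq_inner inner_diff inners)
  have CS: "((Z *\<^sub>R x - X *\<^sub>R w) \<bullet> (Z *\<^sub>R y - Y *\<^sub>R w))\<^sup>2
      \<le> ((Z *\<^sub>R x - X *\<^sub>R w) \<bullet> (Z *\<^sub>R x - X *\<^sub>R w)) * ((Z *\<^sub>R y - Y *\<^sub>R w) \<bullet> (Z *\<^sub>R y - Y *\<^sub>R w))"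
    by (rule Cauchy_Schwarz_ineq)
  have prods: "(Z *\<^sub>R x - X *\<^sub>R w) \<bullet> (Z *\<^sub>R y - Y *\<^sub>R w) = Z * (Z * e - Y * g - X * f + X * Y)"
    "(Z *\<^sub>R x - X *\<^sub>R w) \<bullet> (Z *\<^sub>R x - X *\<^sub>R w) = Z * X * (X + Z - 2 * g)"
    "(Z *\<^sub>R y - Y *\<^sub>R w) \<bullet> (Z *\<^sub>R y - Y *\<^sub>R w) = Z * Y * (Y + Z - 2 * f)"
    by (simp_all add: inner_diff inners algebra_simps)
  have "Z\<^sup>2 * (Z * e - Y * g - X * f + X * Y)\<^sup>2
      \<le> Z\<^sup>2 * (X * (X + Z - 2 * g) * (Y * (Y + Z - 2 * f)))"
    using CS unfolding prods by (simp add: power_mult_distrib power2_eq_square algebra_simps)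
  moreover have "Z > 0"
    using assms by (simp add: Z_def w_def)
  ultimately have "(Z * e - Y * g - X * f + X * Y)\<^sup>2 \<le> X * (X + Z - 2 * g) * (Y * (Y + Z - 2 * f))"
    by simp
  then show ?thesis
    unfolding diffs norms by (simp add: power2_eq_square algebra_simps)
qed

lemma sqdist_Euclidean:
  assumes "tau C i \<in> \<real>" "tau C j \<in> \<real>"
  shows "sqdist C i j =
    of_real ((norm ((Re (tau C i), space_part C i) - (Re (tau C j), space_part C j)))\<^sup>2)"
proof -
  have "tau C i = of_real (Re (tau C i))" "tau C j = of_real (Re (tau C j))"
    using assms by (simp_all add: of_real_Re)
  then have "sqdist C i j = of_real ((Re (tau C i) - Re (tau C j))\<^sup>2 + (norm (space_part C i - space_part C j))\<^sup>2)"
    unfolding sqdist_def by (metis of_real_add of_real_diff of_real_power)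
  then show ?thesis
    by (simp add: norm_Pair)
qed

text \<open>If z were real, so would be zb = u / z, and the discriminant would be the square of a
  real number. By Cauchy-Schwarz \<open>kallen\<close> is nonpositive at Euclidean points, so it
  would have to vanish.\<close>

lemma Euclidean_zzb_nonreal:
  assumes C: "C \<in> confs_E" "kallen C \<noteq> 0" and zz: "is_zzb C z zb"
  shows "z \<notin> \<real>"
proof
  assume "z \<in> \<real>"
  have conf: "C \<in> confs" "\<And>k. tau C k \<in> \<real>"
    using C by (auto simp: confs_E_def)
  define X where "X k = (Re (tau C k), space_part C k)" for k
  define N where "N i j = (norm (X i - X j))\<^sup>2" for i j
  have sq: "sqdist C i j = of_real (N i j)" for i j
    unfolding X_def N_def using conf(2) by (intro sqdist_Euclidean)
  have "X 3 \<noteq> X 4"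
    using conf(1) by (auto simp: X_def confs_def)
  define r where "r = (N 1 3 * N 2 4 + N 1 2 * N 3 4 - N 1 4 * N 2 3)\<^sup>2
    - 4 * (N 1 2 * N 3 4) * (N 1 3 * N 2 4)"
  have "r \<le> 0"
    using Euclidean_kallen_nonpos[OF \<open>X 3 \<noteq> X 4\<close>, of "X 1" "X 2"] by (simp add: r_def N_def)
  have r: "kallen C = of_real r"
    by (simp add: kallen_def sq r_def)
  have reg: "C \<in> regular_confs"
    using conf(1) confs_subset_regular by blast
  have "cross_u C = z * zb" "z \<noteq> 0" "cross_u C \<in> \<real>"
    using zz Euclidean_cross_ratios(2)[OF C(1)] regular_zzb(1)[OF reg zz] by (simp_all add: is_zzb_def)
  then have "zb = cross_u C / z" by simp
  then have "z - zb \<in> \<real>"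
    using \<open>z \<in> \<real>\<close> \<open>cross_u C \<in> \<real>\<close> by simp
  then obtain x where x: "z - zb = of_real x"
    by (auto elim: Reals_cases)
  define y where "y = N 1 3 * N 2 4"
  have y: "sqdist C 1 3 * sqdist C 2 4 = of_real y"
    by (simp add: sq y_def)
  have "y \<noteq> 0"
    using regular_sqdist_nonzero(3,4)[OF reg] y by auto
  then have "of_real (x\<^sup>2 * y\<^sup>2) = (of_real r :: complex)"
    using is_zzb_discr[OF zz] discr_kallen[OF reg] r x y \<open>y \<noteq> 0\<close> by (simp add: field_simps)
  then have "x\<^sup>2 * y\<^sup>2 = r"
    using of_real_eq_iff by blast
  then have "r = 0"
    using \<open>r \<le> 0\<close> by (metis antisym mult_nonneg_nonneg zero_le_power2)
  then show False
    using C(2) r by simp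
qed

text \<open>Lets polynomial dependence be derived by structural rules without writing the polynomial
  down. The embedding \<open>e\<close> is \<open>of_real\<close> for segments and the identity for
  the complexified Wick rotation.\<close>

definition polynomial_along :: "('a \<Rightarrow> 'b::field) \<Rightarrow> ('a \<Rightarrow> 'b) \<Rightarrow> bool" where
  "polynomial_along e f \<longleftrightarrow> (\<exists>p. \<forall>x. f x = poly p (e x))"

lemma polynomial_along_const: "polynomial_along e (\<lambda>x. c)"
  unfolding polynomial_along_def by (intro exI[of _ "[:c:]"]) simp

lemma polynomial_along_self: "polynomial_along e e"
  unfolding polynomial_along_def by (intro exI[of _ "[:0, 1:]"]) simp

lemma polynomial_along_add:
  "polynomial_along e f \<Longrightarrow> polynomial_along e g \<Longrightarrow> polynomial_along e (\<lambda>x. f x + g x)"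
  unfolding polynomial_along_def by (metis poly_add)

lemma polynomial_along_diff:
  "polynomial_along e f \<Longrightarrow> polynomial_along e g \<Longrightarrow> polynomial_along e (\<lambda>x. f x - g x)"
  unfolding polynomial_along_def by (metis poly_diff)

lemma polynomial_along_mult:
  "polynomial_along e f \<Longrightarrow> polynomial_along e g \<Longrightarrow> polynomial_along e (\<lambda>x. f x * g x)"
  unfolding polynomial_along_def by (metis poly_mult)

lemma polynomial_along_power: "polynomial_along e f \<Longrightarrow> polynomial_along e (\<lambda>x. f x ^ n)"
  unfolding polynomial_along_def by (metis poly_power)

lemmas polynomial_along_intros = polynomial_along_const polynomial_along_self polynomial_along_add
  polynomial_along_diff polynomial_along_mult polynomial_along_power

lemma polynomial_along_finite_zeros:
  assumes "polynomial_along e f" "inj e" "f x \<noteq> 0"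
  shows "finite {x. f x = 0}"
proof -
  obtain p where p: "\<And>x. f x = poly p (e x)"
    using assms(1) by (auto simp: polynomial_along_def)
  then have "p \<noteq> 0"
    using assms(3) by auto
  then have "finite {y. poly p y = 0}"
    by (rule poly_roots_finite)
  then have "finite (e -` {y. poly p y = 0})"
    using assms(2) by (rule finite_vimageI)
  then show ?thesis
    by (simp add: p vimage_def)
qed

section \<open>The Kallen function along segments and Wick rotations\<close>

lemma kallen_polynomial_along:
  assumes "\<And>i j. polynomial_along e (\<lambda>s. sqdist (\<gamma> s) i j)"
  shows "polynomial_along e (\<lambda>s. kallen (\<gamma> s))"
  unfolding kallen_def by (intro polynomial_along_intros assms)

lemma tau_linepath: "tau (linepath A B s) k = (1 - of_real s) * tau A k + of_real s * tau B k"
  by (simp add: tau_def linepath_def scaleR_conv_of_real)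

lemma space_part_linepath: "space_part (linepath A B s) k = linepath (space_part A k) (space_part B k) s"
  by (simp add: space_part_def linepath_def)

text \<open>The spatial norm enters only squared, so every squared distance is a quadratic
  polynomial in the segment parameter.\<close>

lemma kallen_linepath: "polynomial_along of_real (\<lambda>s. kallen (linepath A B s))"
proof (rule kallen_polynomial_along)
  fix i j
  define x y where "x = space_part A i - space_part A j" and "y = space_part B i - space_part B j"
  have diff: "space_part (linepath A B s) i - space_part (linepath A B s) j = (1 - s) *\<^sub>R x + s *\<^sub>R y" for s
    unfolding space_part_linepath by (simp add: linepath_def x_def y_def algebra_simps)
  have norm_sq: "(norm (space_part (linepath A B s) i - space_part (linepath A B s) j))\<^sup>2
      = (1 - s)\<^sup>2 * (x \<bullet> x) + 2 * (1 - s) * s * (x \<bullet> y) + s\<^sup>2 * (y \<bullet> y)" for s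
    unfolding diff power2_norm_eq_inner inner_add_left inner_add_right inner_scaleR_left inner_scaleR_right
      inner_commute[of y x]
    by (simp add: power2_eq_square algebra_simps)
  have "sqdist (linepath A B s) i j
      = ((1 - of_real s) * tau A i + of_real s * tau B i - ((1 - of_real s) * tau A j + of_real s * tau B j))\<^sup>2
        + ((1 - of_real s)\<^sup>2 * of_real (x \<bullet> x) + 2 * (1 - of_real s) * of_real s * of_real (x \<bullet> y)
           + (of_real s)\<^sup>2 * of_real (y \<bullet> y))" for s
    unfolding sqdist_def tau_linepath norm_sq
    by (simp only: of_real_add of_real_mult of_real_power of_real_diff of_real_1 of_real_numeral)
  then show "polynomial_along of_real (\<lambda>s. sqdist (linepath A B s) i j)"
    by (simp only:) (intro polynomial_along_intros)
qed

text \<open>The complexification of the Wick rotation: \<open>w = \<i>\<close> gives \<open>C\<close>, real \<open>w\<close> give Euclidean points.\<close>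

definition wick_line :: "'n::finite config \<Rightarrow> complex \<Rightarrow> 'n config" where
  "wick_line C w = (\<chi> k. (of_real (Re (tau C k)) + w * of_real (Im (tau C k)), space_part C k))"

lemma tau_wick_line: "tau (wick_line C w) k = of_real (Re (tau C k)) + w * of_real (Im (tau C k))"
  by (simp add: tau_def wick_line_def)

lemma space_part_wick_line: "space_part (wick_line C w) k = space_part C k"
  by (simp add: space_part_def wick_line_def)

lemma wick_line_ii: "wick_line C \<i> = C"
  by (simp add: wick_line_def vec_eq_iff tau_def space_part_def prod_eq_iff complex_eq_iff)

lemma kallen_wick_line: "polynomial_along (\<lambda>w. w) (\<lambda>w. kallen (wick_line C w))"
  by (rule kallen_polynomial_along)
    (simp add: sqdist_def tau_wick_line space_part_wick_line, intro polynomial_along_intros)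

lemma continuous_on_wick_line: "continuous_on S (wick_line C)"
  unfolding wick_line_def by (intro continuous_on_vec_lambda continuous_intros)

text \<open>The real parts of the time differences are affine in \<open>Re w\<close>, so each of the
  three ordering conditions is an open half-plane, possibly the whole plane.\<close>

lemma wick_line_confs:
  shows "open {w. wick_line C w \<in> confs}" "convex {w. wick_line C w \<in> confs}"
proof -
  define H where "H i j = {w. Re (tau C i - tau C j) + Re w * Im (tau C i - tau C j) > 0}" for i j
  have eq: "{w. wick_line C w \<in> confs} = H 1 2 \<inter> H 2 3 \<inter> H 3 4"
    by (auto simp: H_def confs_def tau_wick_line algebra_simps)
  have H: "H i j = {w. of_real (Im (tau C i - tau C j)) \<bullet> w > - Re (tau C i - tau C j)}" for i j
    by (auto simp: H_def inner_complex_def algebra_simps)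
  have "open (H i j)" "convex (H i j)" for i j
    unfolding H by (rule open_halfspace_gt convex_halfspace_gt)+
  then show "open {w. wick_line C w \<in> confs}" "convex {w. wick_line C w \<in> confs}"
    unfolding eq by (auto intro!: convex_Int)
qed

text \<open>The admissible \<open>w\<close> form a convex open set containing \<open>0\<close> and
  \<open>\<i>\<close>. Removing the finitely many zeros of \<open>kallen\<close> keeps it path
  connected. The path starts at a small real \<open>r\<close>, which is still Euclidean, because
  \<open>0\<close> itself may be a zero.\<close>

lemma Euclidean_path_to_conf:
  assumes C: "C \<in> confs" "kallen C \<noteq> 0"
  shows "\<exists>\<gamma>. path \<gamma> \<and> pathstart \<gamma> \<in> confs_E \<and> path_image \<gamma> \<subseteq> {C \<in> confs. kallen C \<noteq> 0} \<and> pathfinish \<gamma> = C"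
proof -
  define W Z where "W = {w. wick_line C w \<in> confs}" and "Z = {w. kallen (wick_line C w) = 0}"
  have "finite Z"
    unfolding Z_def using kallen_wick_line C(2)
    by (intro polynomial_along_finite_zeros[where x = \<i> and e = "\<lambda>w. w"]) (auto simp: wick_line_ii)
  have W: "open W" "convex W"
    unfolding W_def by (rule wick_line_confs)+
  have "0 \<in> W"
    using C(1) by (simp add: W_def confs_def tau_wick_line)
  then obtain e where e: "e > 0" "ball 0 e \<subseteq> W"
    using W(1) open_contains_ball by blast
  have "finite (of_real -` Z :: real set)"
    using \<open>finite Z\<close> by (intro finite_vimageI) (auto simp: inj_def)
  then have "infinite ({0<..<e} - of_real -` Z)"
    using e(1) by (simp add: infinite_Ioo)
  then obtain r where r: "r \<in> {0<..<e} - of_real -` Z"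
    using infinite_imp_nonempty by blast
  have "of_real r \<in> W"
    using r e by (auto simp: subset_iff)
  have "path_connected (W - Z)"
    using \<open>finite Z\<close> W
    by (intro path_connected_open_diff_countable) (auto simp: convex_connected countable_finite)
  moreover have "of_real r \<in> W - Z" "\<i> \<in> W - Z"
    using \<open>of_real r \<in> W\<close> r C by (auto simp: W_def Z_def wick_line_ii)
  ultimately obtain g where g: "path g" "path_image g \<subseteq> W - Z" "pathstart g = of_real r" "pathfinish g = \<i>"
    unfolding path_connected_def by blast
  show ?thesis
  proof (intro exI[of _ "wick_line C \<circ> g"] conjI)
    show "path (wick_line C \<circ> g)"
      using g(1) continuous_on_wick_line by (rule path_continuous_image)
    show "pathstart (wick_line C \<circ> g) \<in> confs_E"
      using \<open>of_real r \<in> W\<close> by (simp add: pathstart_compose g confs_E_def W_def tau_wick_line)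
    show "path_image (wick_line C \<circ> g) \<subseteq> {C \<in> confs. kallen C \<noteq> 0}"
      using g(2) by (auto simp: path_image_compose W_def Z_def)
    show "pathfinish (wick_line C \<circ> g) = C"
      by (simp add: pathfinish_compose g wick_line_ii)
  qed
qed

section \<open>Admissible paths to Lorentzian configurations\<close>

lemma exists_kallen_nonzero: "\<exists>C::'n::finite config. C \<in> confs \<and> kallen C \<noteq> 0"
proof -
  \<comment> \<open>Three points on a line and a fourth off it lie on no common line or circle,
    which excludes equality in the Cauchy-Schwarz bound.\<close>
  define C :: "'n config" where
    "C = (\<chi> k. if k = 1 then (3, 0) else if k = 2 then (2, 0) else if k = 3 then (1, 0)
        else (0, axis undefined 1))"
  have t: "tau C 1 = 3" "tau C 2 = 2" "tau C 3 = 1" "tau C 4 = 0"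
    and x: "space_part C 1 = 0" "space_part C 2 = 0" "space_part C 3 = 0" "space_part C 4 = axis undefined 1"
    by (simp_all add: C_def tau_def space_part_def)
  have "sqdist C 1 2 = 1" "sqdist C 3 4 = 2" "sqdist C 1 3 = 4" "sqdist C 2 4 = 5"
    "sqdist C 1 4 = 10" "sqdist C 2 3 = 1"
    by (simp_all add: sqdist_def t x norm_axis_1 power2_eq_square)
  then have "kallen C = - 16"
    by (simp add: kallen_def)
  moreover have "C \<in> confs"
    by (simp add: confs_def t)
  ultimately show ?thesis
    by (metis neg_equal_0_iff_equal zero_neq_numeral)
qed

lemma linepath_in_confs:
  assumes "A \<in> confs" "\<And>k. Re (tau C k) = 0" "s < 1"
  shows "linepath A C s \<in> confs"
  using assms by (simp add: confs_def tau_linepath)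

text \<open>A segment from a generic \<open>A\<close> to \<open>C\<close> meets the zeros of
  \<open>kallen\<close> finitely often. Only its last stretch, free of zeros before
  \<open>C\<close>, is kept; the point \<open>B\<close> where it begins is reached from a Euclidean
  one by Wick rotation. At \<open>C\<close> itself \<open>kallen\<close> may vanish.\<close>

lemma path_avoiding_Gamma:
  fixes C :: "'n::finite config"
  assumes C: "\<And>k. Re (tau C k) = 0"
  shows "\<exists>\<gamma>. path \<gamma> \<and> \<gamma> 0 \<in> confs_E \<and> (\<forall>s\<in>{0..<1}. \<gamma> s \<in> confs \<and> kallen (\<gamma> s) \<noteq> 0) \<and> \<gamma> 1 = C"
proof -
  obtain A :: "'n config" where A: "A \<in> confs" "kallen A \<noteq> 0"
    using exists_kallen_nonzero by blast
  define Z where "Z = {s. kallen (linepath A C s) = 0}"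
  have "finite Z"
    unfolding Z_def
    using A(2) kallen_linepath by (intro polynomial_along_finite_zeros[where x = 0 and e = of_real])
      (auto simp: inj_def linepath_def)
  \<comment> \<open>The last zero before the end, or 0 if there is none later;
    \<open>insert 0\<close> keeps the set nonempty for \<open>Max\<close>.\<close>
  define m where "m = Max (insert 0 (Z \<inter> {..<1}))"
  have m: "0 \<le> m" "m < 1" "\<And>s. s \<in> Z \<Longrightarrow> s < 1 \<Longrightarrow> s \<le> m"
    using \<open>finite Z\<close> by (auto simp: m_def)
  define s0 where "s0 = (m + 1) / 2"
  have s0: "0 < s0" "s0 < 1" "m < s0"
    using m by (auto simp: s0_def field_simps)
  have good: "linepath A C s \<in> confs" "kallen (linepath A C s) \<noteq> 0" if "s0 \<le> s" "s < 1" for s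
    using linepath_in_confs[OF A(1) C that(2)] m(3)[of s] that s0(3) by (auto simp: Z_def)
  define B where "B = linepath A C s0"
  obtain g where g: "path g" "pathstart g \<in> confs_E" "path_image g \<subseteq> {C \<in> confs. kallen C \<noteq> 0}"
    "pathfinish g = B"
    using Euclidean_path_to_conf[of B] good[of s0] s0 by (auto simp: B_def)
  define h where "h = linepath B C"
  have h: "h t = linepath A C (s0 + t * (1 - s0))" for t
    by (simp add: h_def B_def linepath_def algebra_simps)
  have h_good: "h t \<in> confs \<and> kallen (h t) \<noteq> 0" if "0 \<le> t" "t < 1" for t
  proof -
    have "t * (1 - s0) < 1 - s0"
      using mult_strict_right_mono[of t 1 "1 - s0"] that s0 by simp
    moreover have "0 \<le> t * (1 - s0)"
      using that s0 by simp
    ultimately have "s0 \<le> s0 + t * (1 - s0) \<and> s0 + t * (1 - s0) < 1"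
      by linarith
    then show ?thesis
      using good unfolding h by blast
  qed
  show ?thesis
  proof (intro exI[of _ "g +++ h"] conjI ballI)
    show "path (g +++ h)"
      using g by (simp add: h_def)
    show "(g +++ h) 0 \<in> confs_E"
      using g(2) by (simp add: joinpaths_def pathstart_def)
    show "(g +++ h) 1 = C"
      by (simp add: joinpaths_def h_def linepath_def)
    fix s :: real assume s: "s \<in> {0..<1}"
    show "(g +++ h) s \<in> confs" "kallen ((g +++ h) s) \<noteq> 0"
    proof -
      have "(g +++ h) s \<in> confs \<and> kallen ((g +++ h) s) \<noteq> 0"
      proof (cases "s \<le> 1 / 2")
        case True
        then have "g (2 * s) \<in> path_image g"
          using s by (auto simp: path_image_def)
        then show ?thesis
          using g(3) True by (auto simp: joinpaths_def)
      next
        case False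
        then show ?thesis
          using h_good[of "2 * s - 1"] s by (auto simp: joinpaths_def)
      qed
      then show "(g +++ h) s \<in> confs" "kallen ((g +++ h) s) \<noteq> 0" by auto
    qed
  qed
qed

text \<open>Halving a continuous logarithm gives the root wherever \<open>D\<close> is nonzero. If
  \<open>D\<close> vanishes at 1, the root built on [0, 1) extends by 0, because its modulus is the
  square root of \<open>norm (D s)\<close> and tends to 0.\<close>

lemma continuous_sqrt_to_boundary:
  fixes D :: "real \<Rightarrow> complex"
  assumes D: "continuous_on {0..1} D" and nz: "\<And>s. s \<in> {0..<1} \<Longrightarrow> D s \<noteq> 0"
  shows "\<exists>q. continuous_on {0..1} q \<and> (\<forall>s\<in>{0..1}. (q s)\<^sup>2 = D s)"
proof (cases "D 1 = 0")
  case False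
  have "D s \<noteq> 0" if "s \<in> {0..1}" for s
    using nz[of s] False that by (cases "s = 1") auto
  then obtain g where "continuous_on {0..1} g" "\<And>s. s \<in> {0..1} \<Longrightarrow> D s = exp (g s)"
    using continuous_logarithm_on_contractible[OF D] convex_imp_contractible
    by (metis convex_real_interval(5))
  then show ?thesis
    by (intro exI[of _ "\<lambda>s. exp (g s / 2)"]) (auto intro!: continuous_intros simp flip: exp_double)
next
  case True
  have "continuous_on {0..<1} D"
    using D by (rule continuous_on_subset) auto
  then obtain g where g: "continuous_on {0..<1} g" "\<And>s. s \<in> {0..<1} \<Longrightarrow> D s = exp (g s)"
    using continuous_logarithm_on_contractible[of "{0..<1}" D] convex_imp_contractible nz
    by (metis convex_real_interval(7))
  define q where "q s = (if s < 1 then exp (g s / 2) else 0)" for s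
  have q: "(q s)\<^sup>2 = D s" if "s \<in> {0..1}" for s
    using that g(2)[of s] True by (auto simp: q_def simp flip: exp_double)
  have "continuous (at s within {0..1}) q" if s: "s \<in> {0..1}" for s
  proof (cases "s = 1")
    case False
    have "continuous_on {0..<1} q"
      using g(1) by (subst continuous_on_cong[OF refl, of _ _ "\<lambda>s. exp (g s / 2)"])
        (auto intro!: continuous_intros simp: q_def)
    then have "continuous (at s within {0..<1}) q"
      using s False by (simp add: continuous_on_eq_continuous_within)
    moreover have "at s within {0..1} = at s within {0..<1}"
      using s False by (intro at_within_nhd[of s "{..<1}"]) auto
    ultimately show ?thesis by simp
  next
    case s1: True
    have "((\<lambda>s. sqrt (norm (D s))) \<longlongrightarrow> sqrt (norm (D 1))) (at 1 within {0..1})"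
      using D by (intro tendsto_intros) (auto simp: continuous_on_def)
    then have "((\<lambda>s. norm (q s)) \<longlongrightarrow> 0) (at 1 within {0..1})"
      unfolding True norm_zero real_sqrt_zero
    proof (rule Lim_transform_eventually)
      show "\<forall>\<^sub>F s in at 1 within {0..1}. sqrt (norm (D s)) = norm (q s)"
        unfolding eventually_at_filter
        by (rule always_eventually) (auto simp: norm_power simp flip: q)
    qed
    then have "(q \<longlongrightarrow> 0) (at 1 within {0..1})"
      by (rule tendsto_norm_zero_cancel)
    then show ?thesis
      by (simp add: continuous_within s1 q_def)
  qed
  then show ?thesis
    using q by (intro exI[of _ q]) (auto simp: continuous_on_eq_continuous_within)
qed

text \<open>A continuous square root of the discriminant turns the quadratic formula into a
  continuation of \<open>z\<close> and \<open>zb\<close>, even if they coincide at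
  \<open>C\<close>.\<close>

lemma path_to_exists:
  fixes C :: "'n::finite config"
  assumes C: "C \<in> confs_L"
  shows "\<exists>\<gamma> z zb. path_to C \<gamma> z zb"
proof -
  obtain \<gamma> :: "real \<Rightarrow> 'n config" where \<gamma>: "path \<gamma>" "\<gamma> 0 \<in> confs_E" "\<gamma> 1 = C"
    "\<And>s. s \<in> {0..<1} \<Longrightarrow> \<gamma> s \<in> confs \<and> kallen (\<gamma> s) \<noteq> 0"
    using path_avoiding_Gamma[of C] C by (auto simp: confs_L_def)
  have reg: "\<gamma> s \<in> regular_confs" if "s \<in> {0..1}" for s
    using that \<gamma>(3,4) C confs_subset_regular confs_L_subset_regular by (cases "s = 1") auto
  have cont: "continuous_on {0..1} \<gamma>"
    using \<gamma>(1) by (simp add: path_def)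
  have uv: "continuous_on {0..1} (\<lambda>s. cross_u (\<gamma> s))" "continuous_on {0..1} (\<lambda>s. cross_v (\<gamma> s))"
    unfolding cross_u_def cross_v_def using regular_sqdist_nonzero[OF reg]
    by (auto intro!: continuous_intros cont)
  then have "continuous_on {0..1} (\<lambda>s. discr (\<gamma> s))"
    unfolding discr_def by (intro continuous_intros)
  moreover have "discr (\<gamma> s) \<noteq> 0" if "s \<in> {0..<1}" for s
    using \<gamma>(4)[OF that] discr_kallen[OF reg, of s] regular_sqdist_nonzero[OF reg, of s] that by auto
  ultimately obtain q where q: "continuous_on {0..1} q" "\<And>s. s \<in> {0..1} \<Longrightarrow> (q s)\<^sup>2 = discr (\<gamma> s)"
    using continuous_sqrt_to_boundary by metis
  \<comment> \<open>\<open>a\<close> will be 1 or -1: the sign of the root is fixed only afterwards,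
    so that the initial imaginary part is positive.\<close>
  define z where "z a s = (1 + cross_u (\<gamma> s) - cross_v (\<gamma> s) + a * q s) / 2" for a s
  have zz: "is_zzb (\<gamma> s) (z a s) (z (- a) s)" if "a\<^sup>2 = 1" "s \<in> {0..1}" for a s
    using is_zzb_sqrt[of "a * q s" "\<gamma> s"] q(2)[OF that(2)] that(1) by (simp add: z_def power_mult_distrib)
  have nonreal: "z 1 0 \<notin> \<real>"
    using Euclidean_zzb_nonreal[OF \<gamma>(2) _ zz[of 1 0]] \<gamma>(4)[of 0] by simp
  have "z (- 1) 0 = cnj (z 1 0)"
    using Euclidean_zzb_cnj[OF \<gamma>(2) _ nonreal] zz[of 1 0] by simp
  then obtain a where a: "a\<^sup>2 = 1" "Im (z a 0) > 0"
  proof (cases "Im (z 1 0) > 0")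
    case True
    then show ?thesis by (intro that[of 1]) auto
  next
    case False
    then have "Im (z (- 1) 0) > 0"
      using nonreal \<open>z (- 1) 0 = cnj (z 1 0)\<close> by (auto simp: complex_is_Real_iff)
    then show ?thesis by (intro that[of "- 1"]) auto
  qed
  have off: "\<gamma> s \<notin> Gamma_set" if "s \<in> {0..<1}" for s
    using \<gamma>(4)[OF that] kallen_not_Gamma by blast
  \<comment> \<open>By continuity \<open>C\<close> is a limit of the earlier points of the path,
    which lie in \<open>confs\<close>.\<close>
  have "C \<in> closure confs"
  proof -
    have "\<gamma> ` closure {0..<1} \<subseteq> closure (\<gamma> ` {0..<1})"
      using cont by (intro image_closure_subset) (auto simp: closure_subset intro: closure_subset[THEN subsetD])
    moreover have "closure (\<gamma> ` {0..<1}) \<subseteq> closure confs"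
      using \<gamma>(4) by (intro closure_mono) auto
    moreover have "\<gamma> 1 \<in> \<gamma> ` closure {0..<1}"
      by (intro imageI) simp
    ultimately show ?thesis
      using \<gamma>(3) by auto
  qed
  moreover have "\<gamma> s \<in> closure confs" if "s \<in> {0..<1}" for s
    using \<gamma>(4)[OF that] closure_subset by blast
  ultimately have "\<gamma> s \<in> closure confs" if "s \<in> {0..1}" for s
    using \<gamma>(3) that by (cases "s = 1") auto
  then have "path_image \<gamma> \<subseteq> closure confs"
    unfolding path_image_def by blast
  moreover have "continuous_on {0..1} (z b)" for b
    unfolding z_def by (intro continuous_intros uv q(1)) auto
  ultimately have "path_to C \<gamma> (z a) (z (- a))"
    unfolding path_to_def using \<gamma> off zz[OF a(1)] a(2) by auto
  then show ?thesis by blast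
qed

section \<open>Dependence on the causal ordering\<close>

lemma real_axis_intervals_disjoint:
  "neg_axis \<inter> unit_interval = {}" "neg_axis \<inter> beyond_one = {}" "unit_interval \<inter> beyond_one = {}"
  by (auto simp: neg_axis_def unit_interval_def beyond_one_def)

lemma Arg_positive_intervals:
  "z \<in> unit_interval \<union> beyond_one \<Longrightarrow> Arg z = 0"
  "z \<in> neg_axis \<union> beyond_one \<Longrightarrow> Arg (moebius_swap z) = 0"
proof -
  show "Arg z = 0" if "z \<in> unit_interval \<union> beyond_one"
    using that by (auto simp: unit_interval_def beyond_one_def)
  show "Arg (moebius_swap z) = 0" if "z \<in> neg_axis \<union> beyond_one"
    using that by (auto simp: neg_axis_def beyond_one_def moebius_swap_of_real divide_less_0_iff
        simp del: of_real_divide)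
qed

lemma nonreal_intervals:
  "z \<notin> \<real> \<Longrightarrow> z \<notin> neg_axis \<and> z \<notin> unit_interval \<and> z \<notin> beyond_one"
  by (auto simp: neg_axis_def unit_interval_def beyond_one_def)

text \<open>Treats T, E_st, E_tu and E_stu together: the principal phases are both zero for positive
  reals and opposite for a conjugate pair. With zero sum, the crossing number is the phase of u,
  which the causal ordering fixes.\<close>

lemma N_t_constant_on:
  assumes A: "A \<subseteq> confs_L_ordered \<alpha>"
    and zz: "\<And>C. C \<in> A \<Longrightarrow> \<exists>z zb. is_zzb C z zb \<and>
      (z \<in> unit_interval \<union> beyond_one \<and> zb \<in> unit_interval \<union> beyond_one \<or> zb = cnj z \<and> z \<notin> \<real>)"
  shows "N_t constant_on A"
proof -
  have phase: "2 * pi * of_int (N_t C) = Im (log_u C)" if C: "C \<in> A" for C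
  proof (rule N_t_eq_phase)
    show "C \<in> confs_L"
      using A C by (auto simp: confs_L_ordered_def)
    then show "\<exists>\<gamma> z zb. path_to C \<gamma> z zb"
      by (rule path_to_exists)
    fix w wb assume w: "is_zzb C w wb"
    obtain z zb where z: "is_zzb C z zb"
      "z \<in> unit_interval \<union> beyond_one \<and> zb \<in> unit_interval \<union> beyond_one \<or> zb = cnj z \<and> z \<notin> \<real>"
      using zz[OF C] by blast
    have "z \<notin> neg_axis \<and> zb \<notin> neg_axis \<and> Arg z + Arg zb = 0"
      using z(2)
    proof (elim disjE conjE)
      assume "z \<in> unit_interval \<union> beyond_one" "zb \<in> unit_interval \<union> beyond_one"
      then show ?thesis
        using Arg_positive_intervals(1) real_axis_intervals_disjoint by auto
    next
      assume "zb = cnj z" "z \<notin> \<real>"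
      then show ?thesis
        using nonreal_intervals[of z] nonreal_intervals[of "cnj z"]
        by (simp add: Arg_cnj complex_is_Real_iff)
    qed
    then show "w \<notin> neg_axis \<and> wb \<notin> neg_axis \<and> Arg w + Arg wb = 0"
      using is_zzb_unique[OF z(1) w] by auto
  qed
  have "N_t C = N_t C'" if "C \<in> A" "C' \<in> A" for C C'
  proof -
    have "2 * pi * of_int (N_t C) = 2 * pi * of_int (N_t C')"
      using phase that A Im_log_u_causal(1)[of C \<alpha> C'] by auto
    then show ?thesis by simp
  qed
  then show ?thesis
    unfolding constant_on_def by metis
qed

text \<open>The counterpart for U, E_su, E_tu and E_stu: r / (r - 1) is positive for r < 0 and for r
  > 1, and conjugate pairs stay conjugate under \<open>moebius_swap\<close>.\<close>

lemma N_u_constant_on: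
  assumes A: "A \<subseteq> confs_L_ordered \<alpha>"
    and zz: "\<And>C. C \<in> A \<Longrightarrow> \<exists>z zb. is_zzb C z zb \<and>
      (z \<in> neg_axis \<union> beyond_one \<and> zb \<in> neg_axis \<union> beyond_one \<or> zb = cnj z \<and> z \<notin> \<real>)"
  shows "N_u constant_on A"
proof -
  have phase: "2 * pi * of_int (N_u C) = - Im (log_u_over_v C)" if C: "C \<in> A" for C
  proof (rule N_u_eq_phase)
    show "C \<in> confs_L"
      using A C by (auto simp: confs_L_ordered_def)
    then show "\<exists>\<gamma> z zb. path_to C \<gamma> z zb"
      by (rule path_to_exists)
    fix w wb assume w: "is_zzb C w wb"
    obtain z zb where z: "is_zzb C z zb"
      "z \<in> neg_axis \<union> beyond_one \<and> zb \<in> neg_axis \<union> beyond_one \<or> zb = cnj z \<and> z \<notin> \<real>"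
      using zz[OF C] by blast
    have "z \<notin> unit_interval \<and> zb \<notin> unit_interval \<and> Arg (moebius_swap z) + Arg (moebius_swap zb) = 0"
      using z(2)
    proof (elim disjE conjE)
      assume "z \<in> neg_axis \<union> beyond_one" "zb \<in> neg_axis \<union> beyond_one"
      then show ?thesis
        using Arg_positive_intervals(2) real_axis_intervals_disjoint by auto
    next
      assume zb: "zb = cnj z" "z \<notin> \<real>"
      then have "z \<noteq> 1" by auto
      then show ?thesis
        using zb nonreal_intervals[of z] nonreal_intervals[of "cnj z"] moebius_swap_real[of z]
        by (simp add: moebius_swap_cnj Arg_cnj complex_is_Real_iff)
    qed
    then show "w \<notin> unit_interval \<and> wb \<notin> unit_interval \<and>
        Arg (moebius_swap w) + Arg (moebius_swap wb) = 0"
      using is_zzb_unique[OF z(1) w] by auto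
  qed
  have "N_u C = N_u C'" if "C \<in> A" "C' \<in> A" for C C'
  proof -
    have "2 * pi * of_int (N_u C) = 2 * pi * of_int (N_u C')"
      using phase that A Im_log_u_causal(2)[of C \<alpha> C'] by auto
    then show ?thesis by simp
  qed
  then show ?thesis
    unfolding constant_on_def by metis
qed

lemma s_channel_convergentI:
  assumes "is_zzb C z zb" "z \<notin> beyond_one" "zb \<notin> beyond_one"
  shows "s_channel_convergent C"
  using assms is_zzb_unique[OF assms(1)] unfolding s_channel_convergent_def by blast

text \<open>The t- and u-channels already fail because \<open>zb\<close> is negative and
  \<open>z\<close> lies in (0, 1), whatever the crossing numbers.\<close>

lemma class_S_only_s_channel: "C \<in> class_S \<Longrightarrow> only_s_channel_convergent C"
proof -
  assume "C \<in> class_S"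
  then obtain z zb where z: "is_zzb C z zb" "z \<in> unit_interval" "zb \<in> neg_axis"
    by (auto simp: class_S_def)
  have "s_channel_convergent C"
    using z real_axis_intervals_disjoint by (intro s_channel_convergentI[OF z(1)]) auto
  then show ?thesis
    using z unfolding only_s_channel_convergent_def t_channel_convergent_def u_channel_convergent_def
    by blast
qed

theorem theorem5p2:
  fixes d :: nat and \<alpha> :: "(4 \<times> 4) set" and DL\<alpha> :: "'n::finite config set"
  assumes "d \<ge> 3" and "CARD('n) = d - 1"
    and "DL\<alpha> = confs_L_ordered \<alpha>"
  shows "(DL\<alpha> \<subseteq> class_S \<longrightarrow> (\<forall>C\<in>DL\<alpha>. only_s_channel_convergent C)) \<and>
    (DL\<alpha> \<subseteq> class_T \<longrightarrow> N_t constant_on DL\<alpha>) \<and>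
    (DL\<alpha> \<subseteq> class_U \<longrightarrow> N_u constant_on DL\<alpha>) \<and>
    (DL\<alpha> \<subseteq> class_E \<longrightarrow>
       ((\<forall>C\<in>DL\<alpha> \<inter> class_E_st. s_channel_convergent C) \<and> N_t constant_on (DL\<alpha> \<inter> class_E_st)) \<and>
       ((\<forall>C\<in>DL\<alpha> \<inter> class_E_su. s_channel_convergent C) \<and> N_u constant_on (DL\<alpha> \<inter> class_E_su)) \<and>
       (N_t constant_on (DL\<alpha> \<inter> class_E_tu) \<and> N_u constant_on (DL\<alpha> \<inter> class_E_tu)) \<and>
       ((\<forall>C\<in>DL\<alpha> \<inter> class_E_stu. s_channel_convergent C) \<and>
         N_t constant_on (DL\<alpha> \<inter> class_E_stu) \<and> N_u constant_on (DL\<alpha> \<inter> class_E_stu)))"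
proof -
  have nonreal_cnj: "cnj z \<notin> \<real>" if "z \<notin> \<real>" for z
    using that by (simp add: complex_is_Real_iff)
  have T: "N_t constant_on DL\<alpha>" if "DL\<alpha> \<subseteq> class_T"
    using that assms(3) by (intro N_t_constant_on[of _ \<alpha>]) (fastforce simp: class_T_def)+
  have U: "N_u constant_on DL\<alpha>" if "DL\<alpha> \<subseteq> class_U"
    using that assms(3) by (intro N_u_constant_on[of _ \<alpha>]) (fastforce simp: class_U_def)+
  have s: "s_channel_convergent C" if C: "C \<in> class_E_st \<union> class_E_su \<union> class_E_stu" for C :: "'n config"
  proof -
    obtain z zb where "is_zzb C z zb" "z \<in> unit_interval \<and> zb \<in> unit_interval \<or>
        z \<in> neg_axis \<and> zb \<in> neg_axis \<or> zb = cnj z \<and> z \<notin> \<real>"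
      using C by (auto simp: class_E_st_def class_E_su_def class_E_stu_def)
    then show ?thesis
      using real_axis_intervals_disjoint nonreal_intervals nonreal_cnj
      by (intro s_channel_convergentI[of C z zb]) blast+
  qed
  have t: "N_t constant_on (DL\<alpha> \<inter> class_E_st)" "N_t constant_on (DL\<alpha> \<inter> class_E_tu)"
    "N_t constant_on (DL\<alpha> \<inter> class_E_stu)"
    using assms(3) by (intro N_t_constant_on[of _ \<alpha>]; fastforce simp: class_E_st_def class_E_tu_def class_E_stu_def)+
  have u: "N_u constant_on (DL\<alpha> \<inter> class_E_su)" "N_u constant_on (DL\<alpha> \<inter> class_E_tu)"
    "N_u constant_on (DL\<alpha> \<inter> class_E_stu)"
    using assms(3) by (intro N_u_constant_on[of _ \<alpha>]; fastforce simp: class_E_su_def class_E_tu_def class_E_stu_def)+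
  show ?thesis
    using class_S_only_s_channel T U s t u by blast
qed

end
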